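(* Let $p_1,p_2$ be primes, $N=p_1p_2$, $D<0$ the discriminant of the order $\mathcal{O}_f$ in an imaginary quadratic field, $B$ an integer with $B^2\equiv D\pmod{4N}$, and let $\mathfrak{N}_B=\{\mathfrak q_i=[A_i,B_i,C_i]: i=1,\dots,h(D)\}$. Let $\mathfrak a_{\mathfrak q_i}=[A_i,\frac{-B_i+\sqrt D}{2}]$ and $W_N(\mathfrak a_{\mathfrak q_i})=[\frac{C_i}{N},\frac{B_i+\sqrt D}{2}]$. Then $J(\mathfrak a_{\mathfrak q_1})=J(W_N(\mathfrak a_{\mathfrak q_1}))$ if and only if $J(\mathfrak a_{\mathfrak q_i})=J(W_N(\mathfrak a_{\mathfrak q_i}))$ for all $i=1,\dots,h(D)$.
   Context: $[\beta_1,\beta_2]=\mathbb{Z}\beta_1+\mathbb{Z}\beta_2$; for a lattice $\mathfrak a=[\beta_1,\beta_2]$ with $\beta_1/\beta_2\in\mathbb{H}$, $J(\mathfrak a)=J(\beta_1/\beta_2)$ where $J$ is the classical modular invariant. $h(D)$ is the class number of $\mathcal{O}_f$. Forms $[A,B,C]=AX^2+BXY+CY^2$ are primitive, positive definite, of discriminant $D$. An $N$-system for $D$ is a set of $h(D)$ primitive forms $[A_i,B_i,C_i]$ of discriminant $D$ with $\gcd(A_i,N)=1$, $N\mid C_i$, $B_i\equiv B_j\pmod{2N}$ for all $i,j$, such that the ideals $[A_i,\frac{-B_i+\sqrt D}{2}]$ represent all proper ideal classes of $\mathcal{O}_f$; $\mathfrak{N}_B$ is an $N$-system containing $[1,B,(B^2-D)/4]$.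 *)

theory Defs
  imports
    "HOL-Analysis.Analysis"
    "HOL-Computational_Algebra.Computational_Algebra"
    "HOL-Number_Theory.Cong"
begin

section \<open>Lattices and the modular invariant\<close>

definition zlattice :: "complex \<Rightarrow> complex \<Rightarrow> complex set" where
  "zlattice \<beta>1 \<beta>2 = {of_int m * \<beta>1 + of_int n * \<beta>2 | m n :: int. True}"

definition eisenstein_G :: "nat \<Rightarrow> complex \<Rightarrow> complex" where
  "eisenstein_G k \<tau> =
     (\<Sum>\<^sub>\<infinity>(m, n)\<in>UNIV - {(0 :: int, 0 :: int)}. 1 / (of_int m * \<tau> + of_int n) ^ k)"

definition modular_g2 :: "complex \<Rightarrow> complex" where
  "modular_g2 \<tau> = 60 * eisenstein_G 4 \<tau>"

definition modular_g3 :: "complex \<Rightarrow> complex" where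
  "modular_g3 \<tau> = 140 * eisenstein_G 6 \<tau>"

text \<open>The normalisation is the one with \<open>q\<close>-expansion \<open>1/q + 744 + ...\<close>, i.e. with value
  1728 at the point \<open>\<i>\<close>. Only values at \<open>\<tau>\<close> with \<open>Im \<tau> > 0\<close> are meaningful.\<close>

definition modular_J :: "complex \<Rightarrow> complex" where
  "modular_J \<tau> = 1728 * modular_g2 \<tau> ^ 3 / (modular_g2 \<tau> ^ 3 - 27 * modular_g3 \<tau> ^ 2)"

text \<open>The value does not depend on the basis, by the invariance of \<open>modular_J\<close> under
  \<open>SL(2, Z)\<close>. A basis given in the opposite orientation has to be swapped first; note that
  \<open>Im (\<beta>1 / \<beta>2) > 0\<close> forces \<open>\<beta>2 \<noteq> 0\<close>.\<close>

definition lattice_J :: "complex set \<Rightarrow> complex" where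
  "lattice_J L =
     (THE j. \<exists>\<beta>1 \<beta>2. Im (\<beta>1 / \<beta>2) > 0 \<and> L = zlattice \<beta>1 \<beta>2 \<and> j = modular_J (\<beta>1 / \<beta>2))"


section \<open>Orders in imaginary quadratic fields\<close>

text \<open>Fields and orders are treated as subsets of the complex numbers. For a negative integer
  \<open>d\<close>, \<open>csqrt (of_int d)\<close> is the square root with positive imaginary part.\<close>

definition imaginary_quadratic_field :: "complex set \<Rightarrow> bool" where
  "imaginary_quadratic_field K \<longleftrightarrow>
     (\<exists>d :: int. d < 0 \<and> squarefree d \<and> K = {x + y * csqrt (of_int d) | x y. x \<in> \<rat> \<and> y \<in> \<rat>})"

definition ring_of_integers :: "complex set \<Rightarrow> complex set" where
  "ring_of_integers K = {z \<in> K. algebraic_int z}"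

text \<open>The order of conductor \<open>f\<close>, for \<open>f > 0\<close>.\<close>

definition conductor_order :: "complex set \<Rightarrow> nat \<Rightarrow> complex set" where
  "conductor_order K f = {of_int m + of_nat f * w | m w. w \<in> ring_of_integers K}"

text \<open>On an imaginary quadratic field the nontrivial automorphism is complex conjugation, so the
  discriminant is the square of the determinant with rows \<open>(\<omega>1, \<omega>2)\<close> and
  \<open>(cnj \<omega>1, cnj \<omega>2)\<close>, for a basis \<open>\<omega>1, \<omega>2\<close> over the integers.\<close>

definition is_order_discriminant :: "complex set \<Rightarrow> int \<Rightarrow> bool" where
  "is_order_discriminant R D \<longleftrightarrow>
     (\<exists>\<omega>1 \<omega>2. R = zlattice \<omega>1 \<omega>2 \<and> of_int D = (\<omega>1 * cnj \<omega>2 - \<omega>2 * cnj \<omega>1)\<^sup>2)"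

definition order_ideal :: "complex set \<Rightarrow> complex set \<Rightarrow> bool" where
  "order_ideal R I \<longleftrightarrow>
     I \<subseteq> R \<and> 0 \<in> I \<and> I \<noteq> {0} \<and>
     (\<forall>x\<in>I. \<forall>y\<in>I. x + y \<in> I) \<and> (\<forall>r\<in>R. \<forall>x\<in>I. r * x \<in> I)"

definition fractional_ideal :: "complex set \<Rightarrow> complex set \<Rightarrow> complex set \<Rightarrow> bool" where
  "fractional_ideal K R I \<longleftrightarrow> (\<exists>\<alpha>\<in>K - {0}. \<exists>I'. order_ideal R I' \<and> I = (*) \<alpha> ` I')"

definition proper_ideals :: "complex set \<Rightarrow> complex set \<Rightarrow> complex set set" where
  "proper_ideals K R = {I. fractional_ideal K R I \<and> {\<beta> \<in> K. (*) \<beta> ` I \<subseteq> I} = R}"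

definition ideal_class_rel :: "complex set \<Rightarrow> complex set \<Rightarrow> complex set rel" where
  "ideal_class_rel K R =
     {(I, I'). I \<in> proper_ideals K R \<and> I' \<in> proper_ideals K R \<and> (\<exists>\<alpha>\<in>K - {0}. I' = (*) \<alpha> ` I)}"

definition proper_ideal_classes :: "complex set \<Rightarrow> complex set \<Rightarrow> complex set set set" where
  "proper_ideal_classes K R = proper_ideals K R // ideal_class_rel K R"

definition class_number :: "complex set \<Rightarrow> complex set \<Rightarrow> nat" where
  "class_number K R = card (proper_ideal_classes K R)"


section \<open>Binary quadratic forms and \<open>N\<close>-systems\<close>

datatype qform = QForm (coeff_A: int) (coeff_B: int) (coeff_C: int)

definition qform_eval :: "qform \<Rightarrow> int \<Rightarrow> int \<Rightarrow> int" where
  "qform_eval q x y = coeff_A q * x\<^sup>2 + coeff_B q * x * y + coeff_C q * y\<^sup>2"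

definition qform_disc :: "qform \<Rightarrow> int" where
  "qform_disc q = (coeff_B q)\<^sup>2 - 4 * coeff_A q * coeff_C q"

definition primitive_form :: "qform \<Rightarrow> bool" where
  "primitive_form q \<longleftrightarrow> Gcd {coeff_A q, coeff_B q, coeff_C q} = 1"

definition positive_definite_form :: "qform \<Rightarrow> bool" where
  "positive_definite_form q \<longleftrightarrow> (\<forall>x y. (x, y) \<noteq> (0, 0) \<longrightarrow> qform_eval q x y > 0)"

definition form_ideal :: "int \<Rightarrow> qform \<Rightarrow> complex set" where
  "form_ideal D q =
     zlattice (of_int (coeff_A q)) ((- of_int (coeff_B q) + csqrt (of_int D)) / 2)"

text \<open>The transform \<open>W\<^sub>N\<close> of \<open>form_ideal D q\<close>, expressed through the form \<open>q\<close>.\<close>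

definition W_form_ideal :: "int \<Rightarrow> int \<Rightarrow> qform \<Rightarrow> complex set" where
  "W_form_ideal N D q =
     zlattice (of_int (coeff_C q) / of_int N) ((of_int (coeff_B q) + csqrt (of_int D)) / 2)"

text \<open>Here \<open>R\<close> is the order of discriminant \<open>D\<close> in \<open>K\<close>.\<close>

definition N_system :: "complex set \<Rightarrow> complex set \<Rightarrow> int \<Rightarrow> int \<Rightarrow> qform set \<Rightarrow> bool" where
  "N_system K R D N S \<longleftrightarrow>
     finite S \<and> card S = class_number K R \<and>
     (\<forall>q\<in>S. primitive_form q \<and> positive_definite_form q \<and> qform_disc q = D \<and>
             gcd (coeff_A q) N = 1 \<and> N dvd coeff_C q) \<and>
     (\<forall>q\<in>S. \<forall>q'\<in>S. [coeff_B q = coeff_B q'] (mod (2 * N))) \<and>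
     (\<forall>c\<in>proper_ideal_classes K R. \<exists>q\<in>S. form_ideal D q \<in> c)"

end

theory Submission
  imports Defs "HOL-Complex_Analysis.Complex_Analysis"
begin

text \<open>Two lattices have the same \<open>J\<close> iff they are homothetic: after rescaling, \<open>g2\<close> and \<open>g3\<close> agree;
  the equation \<open>\<wp>'' = 6 \<wp>\<^sup>2 - g2 / 2\<close> then determines the Laurent expansion of \<open>\<wp>\<close> at 0, and the
  lattice is its set of poles. Homothety reduces the theorem to arithmetic: with
  \<open>\<theta> = (-B + \<surd>D) / 2\<close>, the lattice \<open>W\<^sub>N\<close> of \<open>[A, \<theta>]\<close> is homothetic to \<open>[A N, \<theta>]\<close>, and \<open>[A, \<theta>]\<close> is
  homothetic to \<open>[A N, \<theta>]\<close> iff the ideal \<open>[N, \<theta>]\<close> of the order \<open>[1, \<theta>]\<close> is principal. The latter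
  two lattices depend only on \<open>B\<close> modulo \<open>2 N\<close>, hence not on the form in the \<open>N\<close>-system.\<close>

section \<open>Even-order Weierstrass functions of a lattice\<close>

text \<open>The modular invariant enters only as a quotient of Eisenstein sums, so its injectivity
  on homothety classes has to be proved; the route taken needs no fundamental domain. The number
  \<open>g3\<close> does not occur in the second-order equation: it sits in the coefficient of
  \<open>z ^ 4\<close>, the only one that the recursion leaves free, which is why two Eisenstein
  sums suffice. The equation itself comes from comparing the lattice sums of orders 2 and 4;
  derivatives are taken only of formal Laurent series, never of a lattice sum. Rescaling to common
  \<open>g2\<close>, \<open>g3\<close> requires a nonzero discriminant, because with
  \<open>x / 0 = 0\<close> equal values of the quotient would otherwise say nothing. That is proved
  with the same uniqueness statement, by comparison with degenerate solutions that have too few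
  poles. On the arithmetic side, both homothety conditions become one condition on the multiplier
  \<mu>: it lies in \<open>zlattice N \<theta>\<close> and has norm \<open>N\<close>, where the
  leading coefficient no longer appears.\<close>

definition eisenstein_sum :: "complex set \<Rightarrow> nat \<Rightarrow> complex" where
  "eisenstein_sum L k = (\<Sum>\<^sub>\<infinity>l\<in>L. 1 / l ^ k)"

definition wp_term :: "nat \<Rightarrow> complex \<Rightarrow> complex \<Rightarrow> complex" where
  "wp_term n z l = 1 / (z - l) ^ n - 1 / (- l) ^ n"

text \<open>Since \<open>1 / 0 = 0\<close>, the summand for \<open>l = 0\<close> is \<open>1 / z ^ n\<close>, so \<open>wp_sum L 2\<close> is \<open>\<wp>\<close> and
  \<open>wp_sum L 4\<close> is \<open>\<wp>'' / 6\<close> minus its constant term.\<close>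

definition wp_sum :: "complex set \<Rightarrow> nat \<Rightarrow> complex \<Rightarrow> complex" where
  "wp_sum L n z = (\<Sum>\<^sub>\<infinity>l\<in>L. wp_term n z l)"

text \<open>Rescaling by \<open>m = norm l / 2\<close> puts \<open>m / (z - l)\<close> and
  \<open>m / (- l)\<close> into the unit disc, where the difference of \<open>n\<close>-th powers is
  at most \<open>n\<close> times the difference of the bases, itself at most
  \<open>R / norm l\<close>. Since \<open>m \<ge> 1\<close>, the remaining \<open>1 / m ^ n\<close>
  can be weakened to \<open>1 / m ^ 2\<close>, giving the exponent 3 for every
  \<open>n\<close>.\<close>

lemma norm_wp_term_le:
  assumes "n \<ge> 2" "norm z \<le> R" "2 * R \<le> norm l" "2 \<le> norm l"
  shows "norm (wp_term n z l) \<le> 4 * real n * R * (1 / norm l ^ 3)"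
proof -
  define m where "m = norm l / 2"
  have m: "m \<ge> 1" "norm l = 2 * m" using assms by (auto simp: m_def)
  have R: "R \<ge> 0" using assms(2) norm_ge_zero order_trans by blast
  have zl: "norm (z - l) \<ge> m"
    using assms norm_triangle_ineq2[of l z] by (simp add: m_def norm_minus_commute)
  define u v where "u = complex_of_real m / (z - l)" and "v = complex_of_real m / (- l)"
  have nz: "z - l \<noteq> 0" "l \<noteq> 0" using zl m by auto
  have u: "norm u \<le> 1" and v: "norm v \<le> 1"
    using zl m nz by (auto simp: u_def v_def norm_divide divide_simps)
  have "u - v = - (of_real m * z / ((z - l) * (- l)))"
    using nz by (simp add: u_def v_def field_simps)
  hence "norm (u - v) = m * norm z / (norm (z - l) * norm l)"
    using m by (simp add: norm_mult norm_divide)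
  also have "\<dots> \<le> m * R / (m * norm l)"
    using zl m nz assms R by (intro divide_mono mult_mono mult_pos_pos) auto
  also have "\<dots> = R / norm l" using m by simp
  finally have uv: "norm (u - v) \<le> R / norm l" .
  have "wp_term n z l = (u ^ n - v ^ n) / of_real m ^ n"
    unfolding wp_term_def u_def v_def power_divide using m by (simp add: diff_divide_distrib)
  hence "norm (wp_term n z l) = norm (u ^ n - v ^ n) / m ^ n"
    using m by (simp add: norm_divide norm_power)
  also have "\<dots> \<le> (real n * norm (u - v)) / m ^ 2"
    using norm_power_diff[OF u v, of n] m assms(1)
    by (intro frac_le power_increasing mult_nonneg_nonneg) auto
  also have "\<dots> \<le> (real n * (R / norm l)) / m ^ 2"
    using uv by (intro divide_right_mono mult_left_mono) auto
  also have "\<dots> = 4 * real n * R * (1 / norm l ^ 3)"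
    using m by (simp add: field_simps power2_eq_square power3_eq_cube)
  finally show ?thesis .
qed

text \<open>No basis is fixed, so that lattices can be compared as sets. Summability with exponent 3
  doubles as discreteness, the term at 0 being \<open>1 / 0 = 0\<close>; \<open>cocompact\<close>
  says that the rank is two.\<close>

locale complex_lattice =
  fixes L :: "complex set"
  assumes zero_mem: "0 \<in> L"
    and diff_mem: "x \<in> L \<Longrightarrow> y \<in> L \<Longrightarrow> x - y \<in> L"
    and summable3: "(\<lambda>l. 1 / norm l ^ 3) summable_on L"
    and cocompact: "\<exists>R. \<forall>z. \<exists>l\<in>L. norm (z - l) \<le> R"
begin

lemma uminus_mem: "x \<in> L \<Longrightarrow> - x \<in> L"
  using diff_mem[OF zero_mem, of x] by simp

lemma add_mem: "x \<in> L \<Longrightarrow> y \<in> L \<Longrightarrow> x + y \<in> L"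
  using diff_mem[of x "- y"] uminus_mem[of y] by simp

text \<open>Infinitely many nonzero points of norm at most \<open>R\<close> would each contribute at
  least \<open>1 / R ^ 3\<close> to a convergent sum.\<close>

lemma finite_cball: "finite {l \<in> L. norm l \<le> R}"
proof (rule ccontr)
  define S where "S = {l \<in> L. norm l \<le> R} - {0}"
  assume "infinite {l \<in> L. norm l \<le> R}"
  hence inf: "infinite S" by (simp add: S_def)
  then obtain x where "x \<in> S" by fastforce
  hence R: "R > 0" unfolding S_def using less_le_trans[of 0 "norm x" R] by auto
  have "(\<lambda>l. 1 / norm l ^ 3) summable_on S"
    by (rule summable_on_subset[OF summable3]) (auto simp: S_def)
  hence "(\<lambda>l. 1 / R ^ 3) summable_on S"
    by (rule summable_on_comparison_test)
       (use R in \<open>auto simp: S_def intro!: divide_left_mono power_mono mult_pos_pos\<close>)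
  thus False using infsum_diverge_constant[of S "1 / R ^ 3"] inf R by auto
qed

lemma not_islimpt: "\<not> z islimpt L"
proof
  assume "z islimpt L"
  hence "infinite (L \<inter> ball z 1)" by (auto simp: islimpt_eq_infinite_ball)
  moreover have "L \<inter> ball z 1 \<subseteq> {l \<in> L. norm l \<le> norm z + 1}"
  proof clarsimp
    fix x assume "x \<in> L" "dist z x < 1"
    thus "norm x \<le> norm z + 1"
      using norm_triangle_ineq2[of x z] by (simp add: dist_norm norm_minus_commute)
  qed
  ultimately show False using finite_cball finite_subset by blast
qed

lemma closed: "closed L"
  using not_islimpt by (auto simp: closed_limpt)

lemma nonzero_bounded_below:
  obtains d where "d > 0" "\<And>l. l \<in> L - {0} \<Longrightarrow> norm l \<ge> d"
proof -
  have "\<forall>\<^sub>F y in at 0. y \<notin> L" using not_islimpt[of 0] by (simp add: islimpt_iff_eventually)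
  then obtain d where "d > 0" "\<And>y. y \<noteq> 0 \<Longrightarrow> dist y 0 < d \<Longrightarrow> y \<notin> L"
    by (auto simp: eventually_at)
  thus ?thesis by (intro that[of d]) force+
qed

text \<open>With the finitely many poles of norm at most \<open>2 * R\<close> set aside, the M-test
  applies on the disc of radius \<open>R\<close>; \<open>R \<ge> 1\<close> ensures that the
  remaining \<open>l\<close> satisfy \<open>norm l \<ge> 2\<close>.\<close>

lemma wp_tail:
  assumes n: "n \<ge> 2" and R: "R \<ge> 1"
  defines "F \<equiv> {l \<in> L. norm l \<le> 2 * R}"
  shows "\<And>z. norm z \<le> R \<Longrightarrow> (\<lambda>l. wp_term n z l) summable_on (L - F)" (is "PROP ?A")
    and "(\<lambda>z. \<Sum>\<^sub>\<infinity>l\<in>L-F. wp_term n z l) holomorphic_on ball 0 R" (is ?B)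
proof -
  have bound: "norm (wp_term n z l) \<le> 4 * real n * R * (1 / norm l ^ 3)"
    if "norm z \<le> R" "l \<in> L - F" for z l
    using that R n by (intro norm_wp_term_le) (auto simp: F_def)
  have M: "(\<lambda>l. 4 * real n * R * (1 / norm l ^ 3)) summable_on (L - F)"
    by (rule summable_on_cmult_right, rule summable_on_subset[OF summable3]) auto
  show "PROP ?A"
    by (rule abs_summable_summable, rule summable_on_comparison_test[OF M]) (use bound in auto)
  have "uniform_limit (cball 0 R) (\<lambda>X z. \<Sum>l\<in>X. wp_term n z l)
          (\<lambda>z. \<Sum>\<^sub>\<infinity>l\<in>L-F. wp_term n z l) (finite_subsets_at_top (L - F))"
    by (rule Weierstrass_m_test_general[OF _ M]) (use bound in auto)
  moreover have "(\<lambda>z. \<Sum>l\<in>X. wp_term n z l) holomorphic_on cball 0 R" if "X \<subseteq> L - F" for X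
    unfolding wp_term_def using that R by (intro holomorphic_intros) (force simp: F_def)+
  hence "eventually (\<lambda>X. continuous_on (cball 0 R) (\<lambda>z. \<Sum>l\<in>X. wp_term n z l) \<and>
           (\<lambda>z. \<Sum>l\<in>X. wp_term n z l) holomorphic_on ball 0 R) (finite_subsets_at_top (L - F))"
    by (intro eventually_finite_subsets_at_top_weakI)
       (auto intro: holomorphic_on_imp_continuous_on holomorphic_on_subset[OF _ ball_subset_cball])
  ultimately show ?B
    using holomorphic_uniform_limit[of 0 R] by (metis finite_subsets_at_top_neq_bot)
qed

lemma summable_wp_term:
  assumes n: "n \<ge> 2"
  shows "(\<lambda>l. wp_term n z l) summable_on L"
proof -
  define R where "R = max 1 (norm z)"
  have "(\<lambda>l. wp_term n z l) summable_on {l \<in> L. norm l \<le> 2 * R} \<union> (L - {l \<in> L. norm l \<le> 2 * R})"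
    by (intro summable_on_union wp_tail(1)[OF n] summable_on_finite finite_cball)
       (auto simp: R_def)
  moreover have "{l \<in> L. norm l \<le> 2 * R} \<union> (L - {l \<in> L. norm l \<le> 2 * R}) = L" by auto
  ultimately show ?thesis by simp
qed

lemma holomorphic_wp_sum:
  assumes n: "n \<ge> 2"
  shows "wp_sum L n holomorphic_on - L"
proof -
  have "wp_sum L n holomorphic_on (ball 0 R - L)" if R: "R \<ge> 1" for R
  proof -
    define F where "F = {l \<in> L. norm l \<le> 2 * R}"
    have "(\<lambda>z. (\<Sum>l\<in>F. wp_term n z l) + (\<Sum>\<^sub>\<infinity>l\<in>L-F. wp_term n z l)) holomorphic_on (ball 0 R - L)"
      unfolding F_def using wp_tail(2)[OF n R]
      by (intro holomorphic_on_add) (auto simp: wp_term_def intro!: holomorphic_intros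
            elim!: holomorphic_on_subset)
    moreover have "wp_sum L n z = (\<Sum>l\<in>F. wp_term n z l) + (\<Sum>\<^sub>\<infinity>l\<in>L-F. wp_term n z l)"
      if "z \<in> ball 0 R - L" for z
    proof -
      have "wp_sum L n z = infsum (wp_term n z) (F \<union> (L - F))"
        by (auto simp: wp_sum_def F_def intro!: arg_cong[where f = "infsum (wp_term n z)"])
      also have "\<dots> = infsum (wp_term n z) F + infsum (wp_term n z) (L - F)"
        using wp_tail(1)[OF n R, of z] that finite_cball
        by (intro infsum_Un_disjoint) (auto simp: F_def)
      finally show ?thesis by (simp add: F_def finite_cball)
    qed
    ultimately show ?thesis by (metis (no_types, lifting) holomorphic_cong)
  qed
  hence "wp_sum L n holomorphic_on (\<Union>z::complex. ball 0 (norm z + 1) - L)"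
    by (intro holomorphic_on_UN_open) (auto simp: open_Diff closed)
  moreover have "z \<in> ball 0 (norm z + 1)" for z :: complex by simp
  ultimately show ?thesis by (elim holomorphic_on_subset) blast
qed

lemma wp_sum_uminus:
  assumes "even n"
  shows "wp_sum L n (- z) = wp_sum L n z"
  unfolding wp_sum_def
proof (rule infsum_reindex_bij_witness[of L uminus uminus L])
  show "wp_term n z (- l) = wp_term n (- z) l" for l
    using assms power_minus_even[of n "z + l"] power_minus_even[of n l] by (simp add: wp_term_def)
qed (auto simp: uminus_mem)

text \<open>Replacing \<open>z\<close> by \<open>z + w\<close> and reindexing changes each summand
  by a quantity free of \<open>z\<close>, so the sum changes by a constant \<open>c\<close>;
  evenness at \<open>z = - w / 2\<close> forces \<open>c = 0\<close>. This also works if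
  \<open>w / 2\<close> is a period, since the identities survive \<open>1 / 0 = 0\<close>.\<close>

lemma wp_sum_add_period:
  assumes n: "n \<ge> 2" "even n" and w: "w \<in> L"
  shows "wp_sum L n (z + w) = wp_sum L n z"
proof -
  define c where "c = (\<Sum>\<^sub>\<infinity>l\<in>L. 1 / (- l) ^ n - 1 / (- l - w) ^ n)"
  have const: "wp_sum L n (z + w) = wp_sum L n z + c" for z
  proof -
    define g where "g = (\<lambda>l. wp_term n (z + w) (l + w))"
    have s: "g summable_on L" and "wp_sum L n (z + w) = infsum g L"
    proof -
      have "g summable_on L \<longleftrightarrow> wp_term n (z + w) summable_on L" unfolding g_def
        by (rule summable_on_reindex_bij_witness[of L "\<lambda>l. l - w" "\<lambda>l. l + w"])
           (auto intro: diff_mem add_mem w)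
      thus "g summable_on L" using summable_wp_term[OF n(1)] by simp
      show "wp_sum L n (z + w) = infsum g L" unfolding wp_sum_def g_def
        by (rule sym, rule infsum_reindex_bij_witness[of L "\<lambda>l. l - w" "\<lambda>l. l + w"])
           (auto intro: diff_mem add_mem w)
    qed
    hence "wp_sum L n (z + w) = infsum (\<lambda>l. wp_term n z l + (g l - wp_term n z l)) L" by simp
    also have "\<dots> = wp_sum L n z + infsum (\<lambda>l. g l - wp_term n z l) L"
      unfolding wp_sum_def
      using summable_on_add[OF s, of "\<lambda>l. - wp_term n z l"] summable_wp_term[OF n(1), of z]
      by (intro infsum_add) (auto simp: summable_on_uminus)
    also have "infsum (\<lambda>l. g l - wp_term n z l) L = c"
      by (simp add: g_def c_def wp_term_def)
    finally show ?thesis .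
  qed
  have "wp_sum L n (- w / 2) = wp_sum L n (w / 2)"
    using wp_sum_uminus[OF n(2), of "w / 2"] by simp
  hence "c = 0" using const[of "- w / 2"] by simp
  thus ?thesis using const by simp
qed

text \<open>Liouville's theorem on the torus: periodicity transfers the removable singularity at 0 to
  every lattice point, and cocompactness makes the resulting entire function bounded.\<close>

lemma periodic_eq_0:
  assumes hol: "f holomorphic_on - L"
    and per: "\<And>z w. w \<in> L \<Longrightarrow> f (z + w) = f z"
    and lim: "f \<midarrow>0\<rightarrow> 0"
    and z: "z \<notin> L"
  shows "f z = 0"
proof -
  \<comment> \<open>Nothing ties \<open>f\<close> on \<open>L\<close> to its nearby values; the
    limit 0 is put in there, and continuity at 0 then moves along the periods.\<close>
  define g where "g = (\<lambda>z. if z \<in> L then 0 else f z)"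
  have memL: "z + w \<in> L \<longleftrightarrow> z \<in> L" if "w \<in> L" for z w
    using that add_mem[of z w] diff_mem[of "z + w" w] by auto
  have gper: "g (z + w) = g z" if "w \<in> L" for z w
    using that per memL by (auto simp: g_def)
  have holg: "g holomorphic_on - L"
    using hol by (rule holomorphic_transform) (auto simp: g_def)
  have "g \<midarrow>0\<rightarrow> 0"
  proof (rule Lim_transform_eventually[OF lim])
    have "\<forall>\<^sub>F y in at 0. y \<notin> L" using not_islimpt[of 0] by (simp add: islimpt_iff_eventually)
    thus "\<forall>\<^sub>F y in at 0. f y = g y" by eventually_elim (auto simp: g_def)
  qed
  hence c0: "isCont g 0" using zero_mem by (simp add: isCont_def g_def)
  have cL: "isCont g w" if "w \<in> L" for w
  proof -
    have "isCont (\<lambda>z. g (z - w)) w"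
      by (rule isCont_o2[where g = g]) (use c0 in \<open>auto intro!: continuous_intros\<close>)
    moreover have "(\<lambda>z. g (z - w)) = g" using gper[of "- w"] that uminus_mem by auto
    ultimately show ?thesis by simp
  qed
  have cont: "isCont g z" for z
    using cL holomorphic_on_imp_continuous_on[OF holg] closed
    by (cases "z \<in> L") (auto simp: continuous_on_eq_continuous_at open_Compl)
  have hol_ball: "g holomorphic_on ball 0 r" for r
  proof (rule no_isolated_singularity)
    show "finite {l \<in> L. norm l \<le> r}" by (rule finite_cball)
    show "g holomorphic_on ball 0 r - {l \<in> L. norm l \<le> r}"
      by (rule holomorphic_on_subset[OF holg]) auto
  qed (use cont in \<open>auto intro!: continuous_at_imp_continuous_on\<close>)
  have "g holomorphic_on (\<Union>z. ball 0 (norm z + 1))"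
    by (intro holomorphic_on_UN_open hol_ball) auto
  hence "g holomorphic_on UNIV" by (rule holomorphic_on_subset) (auto intro!: exI)
  moreover obtain R where R: "\<And>z. \<exists>l\<in>L. norm (z - l) \<le> R" using cocompact by auto
  have "bounded (range g)"
  proof -
    have "compact (g ` cball 0 R)"
      by (intro compact_continuous_image continuous_at_imp_continuous_on) (use cont in auto)
    moreover have "range g \<subseteq> g ` cball 0 R"
    proof clarify
      fix z
      obtain l where l: "l \<in> L" "norm (z - l) \<le> R" using R by blast
      hence "g z = g (z - l)" using gper[of l "z - l"] by simp
      thus "g z \<in> g ` cball 0 R" using l by auto
    qed
    ultimately show ?thesis using bounded_subset compact_imp_bounded by blast
  qed
  ultimately have "g constant_on UNIV" by (rule Liouville_theorem)
  hence "g z = g 0" by (auto simp: constant_on_def)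
  thus ?thesis using z zero_mem by (simp add: g_def)
qed

end

section \<open>Expansion at the origin\<close>

lemma negative_binomial_sums:
  fixes x :: complex
  assumes "norm x < 1" "n > 0"
  shows "(\<lambda>k. of_nat ((n + k - 1) choose k) * x ^ k) sums (1 / (1 - x) ^ n)"
proof -
  have nz: "1 - x \<noteq> 0" using assms by auto
  have "(\<lambda>k. ((- of_nat n) gchoose k) * (- x) ^ k) sums (1 + - x) powr (- of_nat n)"
    by (rule gen_binomial_complex) (use assms in auto)
  also have "(1 + - x) powr (- of_nat n) = 1 / (1 - x) ^ n"
    using nz by (simp add: powr_minus powr_nat' inverse_eq_divide)
  also have "(\<lambda>k. ((- of_nat n) gchoose k) * (- x) ^ k) =
      (\<lambda>k. of_nat ((n + k - 1) choose k) * x ^ k)"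
  proof
    fix k
    have "of_nat n + of_nat k - 1 = (of_nat (n + k - 1) :: complex)"
      using assms(2) by (simp add: of_nat_diff)
    moreover have "(- x) ^ k = (- 1) ^ k * x ^ k" by (rule power_minus)
    ultimately show "((- of_nat n) gchoose k) * (- x) ^ k = of_nat ((n + k - 1) choose k) * x ^ k"
      unfolding binomial_gbinomial gbinomial_minus by simp
  qed
  finally show ?thesis .
qed

text \<open>The binomial coefficient of \<open>x ^ k\<close> in \<open>1 / (1 - x) ^ n\<close>, with
  the constant term dropped because \<open>wp_term\<close> subtracts it.\<close>

definition wp_coeff :: "nat \<Rightarrow> nat \<Rightarrow> nat" where
  "wp_coeff n k = (if k = 0 then 0 else (n + k - 1) choose k)"

lemma wp_term_sums:
  assumes "norm z < norm l" "even n" "n > 0"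
  shows "(\<lambda>k. of_nat (wp_coeff n k) * z ^ k / l ^ (n + k)) sums wp_term n z l"
proof -
  have l: "l \<noteq> 0" using assms(1) by auto
  have "(\<lambda>k. of_nat ((n + k - 1) choose k) * (z / l) ^ k) sums (1 / (1 - z / l) ^ n)"
    using assms l by (intro negative_binomial_sums) (simp_all add: norm_divide)
  hence "(\<lambda>k. 1 / l ^ n * (of_nat ((n + k - 1) choose k) * (z / l) ^ k)) sums
           (1 / l ^ n * (1 / (1 - z / l) ^ n))"
    by (rule sums_mult)
  also have "1 / l ^ n * (1 / (1 - z / l) ^ n) = 1 / (z - l) ^ n"
  proof -
    have "l ^ n * (1 - z / l) ^ n = (l - z) ^ n"
      using l by (simp flip: power_mult_distrib add: field_simps)
    also have "\<dots> = (z - l) ^ n"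
      using power_minus_even[OF assms(2), of "z - l"] by simp
    finally show ?thesis by (simp add: field_simps)
  qed
  finally have "(\<lambda>k. 1 / l ^ n * (of_nat ((n + k - 1) choose k) * (z / l) ^ k)
                   - (if k = 0 then 1 / l ^ n else 0)) sums (1 / (z - l) ^ n - 1 / l ^ n)"
    by (intro sums_diff) (use sums_single[of 0 "\<lambda>_. 1 / l ^ n"] in auto)
  also have "(\<lambda>k. 1 / l ^ n * (of_nat ((n + k - 1) choose k) * (z / l) ^ k)
                   - (if k = 0 then 1 / l ^ n else 0)) =
             (\<lambda>k. of_nat (wp_coeff n k) * z ^ k / l ^ (n + k))"
    by (auto simp: wp_coeff_def power_add power_divide)
  also have "1 / (z - l) ^ n - 1 / l ^ n = wp_term n z l"
    using power_minus_even[OF assms(2), of l] by (simp add: wp_term_def)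
  finally show ?thesis .
qed

definition wp_fps :: "complex set \<Rightarrow> nat \<Rightarrow> complex fps" where
  "wp_fps L n = Abs_fps (\<lambda>k. of_nat (wp_coeff n k) * eisenstein_sum L (n + k))"

definition wp_fls :: "complex set \<Rightarrow> nat \<Rightarrow> complex fls" where
  "wp_fls L n = fls_X_inv ^ n + fps_to_fls (wp_fps L n)"

lemma fls_X_inv_power_nth:
  "fls_nth ((fls_X_inv :: complex fls) ^ n) k = (if k = - int n then 1 else 0)"
  by (auto simp: fls_X_inv_power_conv_shift_1)

lemma wp_fls_nth:
  "fls_nth (wp_fls L n) k = (if k = - int n then 1 else 0) +
     (if k < 0 then 0 else of_nat (wp_coeff n (nat k)) * eisenstein_sum L (n + nat k))"
  by (simp add: wp_fls_def wp_fps_def fls_X_inv_power_nth)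

context complex_lattice
begin

lemma eisenstein_sum_nonzero:
  assumes "k > 0"
  shows "eisenstein_sum L k = (\<Sum>\<^sub>\<infinity>l\<in>L - {0}. 1 / l ^ k)"
  unfolding eisenstein_sum_def using assms by (intro infsum_cong_neutral) auto

lemma eisenstein_sum_odd:
  assumes "odd k"
  shows "eisenstein_sum L k = 0"
proof -
  have "eisenstein_sum L k = (\<Sum>\<^sub>\<infinity>l\<in>L. - (1 / l ^ k))"
    unfolding eisenstein_sum_def
    by (rule infsum_reindex_bij_witness[of L uminus uminus L])
       (use assms in \<open>auto simp: uminus_mem power_minus_odd\<close>)
  also have "\<dots> = - eisenstein_sum L k" by (simp add: infsum_uminus eisenstein_sum_def)
  finally show ?thesis by simp
qed

text \<open>Each summand with \<open>l \<noteq> 0\<close> is expanded in powers of \<open>z\<close>,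
  and the two summations are exchanged by absolute convergence for \<open>norm z < d / 2\<close>,
  with \<open>d\<close> a lower bound for the nonzero lattice norms.\<close>

lemma wp_sum_has_fps_expansion:
  assumes n: "n \<ge> 2" "even n"
  shows "(\<lambda>z. wp_sum L n z - 1 / z ^ n) has_fps_expansion wp_fps L n"
proof (rule has_fps_expansionI)
  obtain d where d: "d > 0" "\<And>l. l \<in> L - {0} \<Longrightarrow> norm l \<ge> d"
    using nonzero_bounded_below by blast
  have "(\<lambda>k. fps_nth (wp_fps L n) k * z ^ k) sums (wp_sum L n z - 1 / z ^ n)"
    if z: "z \<in> ball 0 (d / 2)" for z
  proof -
    define g where "g = (\<lambda>l k. of_nat (wp_coeff n k) * z ^ k / l ^ (n + k))"
    define u where "u = (\<lambda>k. real (wp_coeff n k) * (1 / 2) ^ k)"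
    \<comment> \<open>Since the coefficient for \<open>k = 0\<close> vanishes, one factor
      \<open>norm z / norm l\<close> is always available; it supplies the extra
      \<open>1 / norm l\<close> without which \<open>n = 2\<close> would not be dominated.
      \<open>C\<close> collects the leftover powers of \<open>d\<close>.\<close>
    define C where "C = 1 / d ^ (n - 2) * d"
    have zl: "norm z \<le> norm l / 2" "norm l > 0" if "l \<in> L - {0}" for l
      using z d(1) d(2)[OF that] by auto
    \<comment> \<open>Up to the factor \<open>2 ^ n\<close>, the series \<open>u\<close> is the
      expansion of the term with \<open>z = 1\<close> and \<open>l = 2\<close>, hence
      summable.\<close>
    have "(\<lambda>k. 2 ^ n * (of_nat (wp_coeff n k) * 1 ^ k / 2 ^ (n + k))) sums (2 ^ n * wp_term n 1 2)"
      by (intro sums_mult wp_term_sums) (use n in auto)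
    hence "(\<lambda>k. complex_of_real (u k)) sums (2 ^ n * wp_term n 1 2)"
      by (simp add: u_def power_add power_divide)
    hence u: "summable u"
      by (metis sums_summable summable_complex_of_real)
    have u0: "u k \<ge> 0" for k by (simp add: u_def)
    hence u_sum: "u summable_on UNIV" using u by (simp add: summable_on_UNIV_nonneg_real_iff)
    have C0: "C \<ge> 0" using d(1) by (simp add: C_def)
    have bound: "norm (g l k) \<le> C * (1 / norm l ^ 3) * u k" if l: "l \<in> L - {0}" for l k
    proof (cases "k = 0")
      case False
      then obtain j where k: "k = Suc j" using not0_implies_Suc by blast
      have lpos: "norm l > 0" using zl(2)[OF l] .
      have "norm z / norm l \<le> 1 / 2" using zl[OF l] by (simp add: field_simps)
      hence "(norm z / norm l) ^ j \<le> (1 / 2) ^ j" by (intro power_mono) auto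
      moreover have "norm z / norm l \<le> (d / 2) / norm l"
        using z by (intro divide_right_mono) auto
      ultimately have 1: "(norm z / norm l) ^ k \<le> (d / 2) / norm l * (1 / 2) ^ j"
        unfolding k power_Suc using d(1) by (intro mult_mono) auto
      have "d ^ (n - 2) * norm l ^ 2 \<le> norm l ^ (n - 2) * norm l ^ 2"
        using d(1) d(2)[OF l] by (intro mult_right_mono power_mono) auto
      also have "norm l ^ (n - 2) * norm l ^ 2 = norm l ^ n"
        using n(1) by (metis le_add_diff_inverse2 power_add)
      finally have "1 / norm l ^ n \<le> 1 / (d ^ (n - 2) * norm l ^ 2)"
        using d(1) lpos by (intro divide_left_mono) auto
      hence "(norm z / norm l) ^ k * (1 / norm l ^ n) \<le>
          (d / 2) / norm l * (1 / 2) ^ j * (1 / (d ^ (n - 2) * norm l ^ 2))"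
        using 1 d(1) by (intro mult_mono) auto
      hence "real (wp_coeff n k) * ((norm z / norm l) ^ k * (1 / norm l ^ n)) \<le>
          real (wp_coeff n k) * ((d / 2) / norm l * (1 / 2) ^ j * (1 / (d ^ (n - 2) * norm l ^ 2)))"
        by (rule mult_left_mono) simp
      also have "\<dots> = C * (1 / norm l ^ 3) * u k"
        by (simp add: C_def u_def k power2_eq_square power3_eq_cube mult_ac)
      also have "real (wp_coeff n k) * ((norm z / norm l) ^ k * (1 / norm l ^ n)) = norm (g l k)"
        by (simp add: g_def norm_mult norm_divide norm_power power_add power_divide mult_ac)
      finally show ?thesis .
    qed (simp add: g_def wp_coeff_def u_def)
    have L3: "(\<lambda>l. C * (1 / norm l ^ 3)) summable_on (L - {0})"
      by (rule summable_on_cmult_right, rule summable_on_subset[OF summable3]) auto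
    have "(\<lambda>(l, k). C * (1 / norm l ^ 3) * u k) summable_on (L - {0}) \<times> UNIV"
    proof (rule summable_on_SigmaI)
      show "((\<lambda>k. case (l, k) of (l, k) \<Rightarrow> C * (1 / norm l ^ 3) * u k) has_sum
              C * (1 / norm l ^ 3) * infsum u UNIV) UNIV" for l :: complex
        unfolding case_prod_conv by (intro has_sum_cmult_right has_sum_infsum u_sum)
      show "(\<lambda>l. C * (1 / norm l ^ 3) * infsum u UNIV) summable_on (L - {0})"
        by (rule summable_on_cmult_left[OF L3])
    qed (use C0 u0 in auto)
    hence "(\<lambda>p. norm (case p of (l, k) \<Rightarrow> g l k)) summable_on (L - {0}) \<times> UNIV"
    proof (rule summable_on_comparison_test)
      fix p :: "complex \<times> nat"
      assume "p \<in> (L - {0}) \<times> UNIV"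
      thus "norm (case p of (l, k) \<Rightarrow> g l k) \<le> (case p of (l, k) \<Rightarrow> C * (1 / norm l ^ 3) * u k)"
        using bound[of "fst p" "snd p"] by (simp add: case_prod_unfold mem_Times_iff)
    qed simp
    hence summ: "(\<lambda>(l, k). g l k) summable_on (L - {0}) \<times> UNIV"
      by (rule abs_summable_summable)
    hence summ': "(\<lambda>(k, l). g l k) summable_on UNIV \<times> (L - {0})"
      by (subst (asm) summable_on_swap) (simp add: case_prod_unfold)
    have inner: "(g l has_sum wp_term n z l) UNIV" if l: "l \<in> L - {0}" for l
    proof (rule norm_summable_imp_has_sum)
      show "summable (\<lambda>k. norm (g l k))"
        by (rule summable_comparison_test'[where g = "\<lambda>k. C * (1 / norm l ^ 3) * u k"])
           (use bound[OF l] u in \<open>auto intro!: summable_mult\<close>)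
      have "norm z < norm l" using zl[OF l] by linarith
      thus "g l sums wp_term n z l"
        unfolding g_def using n by (intro wp_term_sums) auto
    qed
    have outer: "infsum (\<lambda>l. g l k) (L - {0}) = fps_nth (wp_fps L n) k * z ^ k" for k
    proof -
      have "infsum (\<lambda>l. g l k) (L - {0}) =
              infsum (\<lambda>l. of_nat (wp_coeff n k) * z ^ k * (1 / l ^ (n + k))) (L - {0})"
        by (simp add: g_def)
      also have "\<dots> = of_nat (wp_coeff n k) * z ^ k * eisenstein_sum L (n + k)"
        using n(1) eisenstein_sum_nonzero[of "n + k"] by (subst infsum_cmult_right') auto
      finally show ?thesis by (simp add: wp_fps_def)
    qed
    have "wp_sum L n z = infsum (wp_term n z) ({0} \<union> (L - {0}))"
      unfolding wp_sum_def using zero_mem by (intro arg_cong2[where f = infsum] refl) auto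
    also have "\<dots> = wp_term n z 0 + infsum (wp_term n z) (L - {0})"
      using summable_on_subset[OF summable_wp_term[OF n(1), of z], of "L - {0}"]
      by (subst infsum_Un_disjoint) auto
    finally have "wp_sum L n z - 1 / z ^ n = infsum (wp_term n z) (L - {0})"
      using n(1) by (simp add: wp_term_def)
    also have "\<dots> = infsum (\<lambda>l. infsum (g l) UNIV) (L - {0})"
      by (intro infsum_cong sym[OF infsumI] inner)
    also have "\<dots> = infsum (\<lambda>k. infsum (\<lambda>l. g l k) (L - {0})) UNIV"
      by (rule infsum_swap_banach[OF summ])
    finally have "((\<lambda>k. infsum (\<lambda>l. g l k) (L - {0})) has_sum (wp_sum L n z - 1 / z ^ n)) UNIV"
      using summable_on_Sigma_banach[OF summ'] by (simp add: has_sum_infsum)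
    thus ?thesis unfolding outer by (rule has_sum_imp_sums)
  qed
  thus "\<forall>\<^sub>F z in nhds 0. (\<lambda>k. fps_nth (wp_fps L n) k * z ^ k) sums (wp_sum L n z - 1 / z ^ n)"
    using d(1) by (intro eventually_nhds_in_open[of "ball 0 (d / 2)", THEN eventually_mono]) auto
qed

end

section \<open>The differential equation and rigidity\<close>

lemma has_laurent_expansion_imp_eventually_eq:
  assumes "f has_laurent_expansion F" "g has_laurent_expansion F"
  shows "\<forall>\<^sub>F z in at 0. f z = g z"
proof -
  have "\<forall>\<^sub>F z in at 0. eval_fls F z = f z" "\<forall>\<^sub>F z in at 0. eval_fls F z = g z"
    using assms by (auto simp: has_laurent_expansion_def)
  thus ?thesis by eventually_elim simp
qed

text \<open>The difference \<open>d\<close> of two solutions satisfies \<open>d'' = 6 d (f + g)\<close>. If \<open>s\<close> is its order,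
  comparing leading coefficients gives \<open>s (s - 1) = 12\<close>, so \<open>s = 4\<close> or \<open>s = -3\<close>.\<close>

lemma weierstrass_ode_unique:
  fixes f g :: "complex fls"
  assumes f: "fls_subdegree f = -2" "fls_nth f (-2) = 1" "fls_deriv (fls_deriv f) = 6 * f ^ 2 - fls_const c"
    and g: "fls_subdegree g = -2" "fls_nth g (-2) = 1" "fls_deriv (fls_deriv g) = 6 * g ^ 2 - fls_const c"
    and nth4: "fls_nth f 4 = fls_nth g 4"
  shows "f = g"
proof (rule ccontr)
  assume "f \<noteq> g"
  define d s where "d = f - g" and "s = fls_subdegree d"
  have "d \<noteq> 0" using \<open>f \<noteq> g\<close> by (simp add: d_def)
  hence ds: "fls_nth d s \<noteq> 0" by (simp add: s_def)
  have below: "fls_nth f k = 0" "fls_nth g k = 0" if "k < -2" for k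
    using that f(1) g(1) fls_eq0_below_subdegree[of k f] fls_eq0_below_subdegree[of k g] by auto
  have sub: "fls_subdegree (f + g) = -2"
    by (rule fls_subdegree_eqI) (use f(2) g(2) below in auto)
  have eq: "fls_deriv (fls_deriv d) = 6 * (d * (f + g))"
    by (simp add: d_def f(3) g(3) algebra_simps power2_eq_square)
  have "of_int (s * (s - 1)) * fls_nth d s = fls_nth (fls_deriv (fls_deriv d)) (s - 2)"
    by (simp add: algebra_simps)
  also have "\<dots> = fls_nth (fls_const 6 * (d * (f + g))) (s + (-2))"
    by (simp add: eq fls_const_numeral)
  also have "\<dots> = 6 * fls_nth (d * (f + g)) (fls_subdegree d + fls_subdegree (f + g))"
    unfolding fls_mult_const_nth(1) sub s_def ..
  also have "\<dots> = 6 * (fls_nth d s * 2)"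
    unfolding fls_times_base using f(2) g(2) by (simp add: sub s_def)
  finally have "of_int (s * (s - 1)) = (of_int 12 :: complex)" using ds by simp
  hence "s * (s - 1) = 12" by (simp only: of_int_eq_iff)
  hence "(s - 4) * (s + 3) = 0" by (simp add: algebra_simps)
  hence "s = 4 \<or> s = -3" by auto
  \<comment> \<open>Exponent -3 lies below the lowest exponent -2 of both series; at exponent 4 the
    equation says nothing, and \<open>nth4\<close> decides.\<close>
  thus False using ds nth4 below[of "-3"] by (auto simp: d_def)
qed

lemma wp_coeff_2: "wp_coeff 2 (Suc j) = Suc (Suc j)"
  by (simp add: wp_coeff_def)

lemma subdegree_wp_fls: "fls_subdegree (wp_fls L 2) = -2"
  by (rule fls_subdegree_eqI) (auto simp: wp_fls_nth)

text \<open>Coefficientwise form of termwise differentiation, resting on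
  \<open>6 * (m + 3 choose m) = (m + 3) * (m + 2) * (m + 1)\<close>. The added constant restores
  what \<open>wp_term 4\<close> subtracts.\<close>

lemma wp_fls_deriv2:
  "fls_deriv (fls_deriv (wp_fls L 2)) = 6 * (wp_fls L 4 + fls_const (eisenstein_sum L 4))"
proof (rule fls_eqI)
  fix k :: int
  have six: "fls_nth (6 * h) n = 6 * fls_nth h n" for h :: "complex fls" and n
    by (metis fls_const_numeral fls_mult_const_nth(1))
  have "k \<ge> 0 \<or> k = -1 \<or> k = -2 \<or> k = -3 \<or> k = -4 \<or> k < -4" by linarith
  thus "fls_nth (fls_deriv (fls_deriv (wp_fls L 2))) k =
        fls_nth (6 * (wp_fls L 4 + fls_const (eisenstein_sum L 4))) k"
  proof (elim disjE)
    assume "k \<ge> 0"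
    then obtain m where k: "k = int m" by (metis nonneg_int_cases)
    have "6 * (m + 3 choose m) = (m + 3) * (m + 2) * (m + 1)"
    proof -
      have "fact 3 * fact m * (m + 3 choose m) = (fact (m + 3) :: nat)"
        using binomial_fact_lemma[of m "m + 3"] by (simp add: mult_ac)
      also have "fact (m + 3) = (m + 3) * (m + 2) * (m + 1) * (fact m :: nat)"
        by (simp add: numeral_3_eq_3 numeral_2_eq_2 algebra_simps)
      finally show ?thesis by (simp add: fact_numeral)
    qed
    hence C: "6 * of_nat (m + 3 choose m) = (of_nat ((m + 3) * (m + 2) * (m + 1)) :: complex)"
      by (metis of_nat_mult of_nat_numeral)
    have f2: "fls_nth (wp_fls L 2) (int m + 2) = of_nat (m + 3) * eisenstein_sum L (m + 4)"
      using wp_coeff_2[of "m + 1"] by (simp add: wp_fls_nth nat_add_distrib eval_nat_numeral)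
    have f4: "fls_nth (wp_fls L 4 + fls_const (eisenstein_sum L 4)) (int m) =
                of_nat (m + 3 choose m) * eisenstein_sum L (m + 4)"
      by (cases "m = 0") (simp_all add: wp_fls_nth wp_coeff_def add_ac)
    have m2: "int m + 1 + 1 = int m + 2" by simp
    show ?thesis
      unfolding k six f4 fls_deriv_nth m2 f2
      using arg_cong[OF C, of "\<lambda>x. x * eisenstein_sum L (m + 4)"] by (simp add: algebra_simps)
  qed (auto simp: six wp_fls_nth wp_coeff_def)
qed

context complex_lattice
begin

lemma wp_sum_has_laurent_expansion:
  assumes n: "n \<ge> 2" "even n"
  shows "wp_sum L n has_laurent_expansion wp_fls L n"
proof -
  have "(\<lambda>z. 1 / z ^ n + (wp_sum L n z - 1 / z ^ n)) has_laurent_expansion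
          (1 / fls_X ^ n + fps_to_fls (wp_fps L n))"
    by (intro laurent_expansion_intros has_laurent_expansion_fps wp_sum_has_fps_expansion n)
  moreover have "1 / (fls_X :: complex fls) ^ n = fls_X_inv ^ n"
    by (simp add: fls_X_inv_power_conv_shift_1 fls_inverse_X inverse_eq_divide[symmetric]
        flip: power_inverse)
  ultimately show ?thesis by (simp add: wp_fls_def)
qed

text \<open>Writing \<open>wp_fls L 2\<close> as \<open>1 / z ^ 2 + z ^ 2 * q\<close>, its square is
  \<open>1 / z ^ 4 + 2 * q + z ^ 4 * q ^ 2\<close>. So the difference \<open>F\<close> has no pole
  at 0, and the constant, twice \<open>q\<close> at 0, makes it vanish there; periodicity then gives
  \<open>F = 0\<close> off \<open>L\<close>.\<close>

lemma wp_fls_4: "wp_fls L 4 = wp_fls L 2 ^ 2 - fls_const (6 * eisenstein_sum L 4)"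
proof -
  define p q where "p = wp_fps L 4" and "q = fps_shift 2 (wp_fps L 2)"
  \<comment> \<open>The constant term vanishes by \<open>wp_coeff\<close>, the linear one because it
    is a multiple of \<open>eisenstein_sum L 3\<close>.\<close>
  have "wp_fps L 2 = fps_X ^ 2 * q"
  proof (rule fps_ext)
    fix k :: nat
    show "fps_nth (wp_fps L 2) k = fps_nth (fps_X ^ 2 * q) k"
    proof (cases "k < 2")
      case True
      hence "k = 0 \<or> k = 1" by linarith
      thus ?thesis
        using eisenstein_sum_odd[of 3]
        by (auto simp: fps_X_power_mult_nth wp_fps_def wp_coeff_def numeral_3_eq_3)
    next
      case False
      hence "Suc (Suc (k - 2)) = k" by linarith
      thus ?thesis using False by (simp add: q_def fps_X_power_mult_nth)
    qed
  qed
  hence f2: "wp_fls L 2 = fls_X_inv ^ 2 + fls_X ^ 2 * fps_to_fls q"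
    by (simp add: wp_fls_def fls_times_fps_to_fls fps_to_fls_power)
  have X: "fls_X * fls_X_inv = (1 :: complex fls)" by (simp flip: fls_inverse_X)
  define r where "r = p - 2 * q - fps_X ^ 4 * q ^ 2 + fps_const (6 * eisenstein_sum L 4)"
  define F where "F = (\<lambda>z. wp_sum L 4 z - wp_sum L 2 z ^ 2 + 6 * eisenstein_sum L 4)"
  have "F has_laurent_expansion (wp_fls L 4 - wp_fls L 2 ^ 2 + fls_const (6 * eisenstein_sum L 4))"
    unfolding F_def by (intro laurent_expansion_intros wp_sum_has_laurent_expansion) auto
  also have "wp_fls L 4 - wp_fls L 2 ^ 2 + fls_const (6 * eisenstein_sum L 4) = fps_to_fls r"
  proof -
    have "wp_fls L 2 ^ 2 = fls_X_inv ^ 4 + 2 * (fls_X * fls_X_inv) ^ 2 * fps_to_fls q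
            + fls_X ^ 4 * fps_to_fls q ^ 2"
      unfolding f2 by (simp add: power2_eq_square power4_eq_xxxx algebra_simps)
    thus ?thesis
      unfolding r_def X by (simp add: wp_fls_def p_def fls_times_fps_to_fls fps_to_fls_power)
  qed
  finally have exp: "F has_laurent_expansion fps_to_fls r" .
  have "F \<midarrow>0\<rightarrow> fls_nth (fps_to_fls r) 0"
    by (rule has_laurent_expansion_imp_tendsto_0[OF exp]) (simp add: fls_subdegree_fls_to_fps)
  moreover have "fps_nth q 0 = 3 * eisenstein_sum L 4"
    using wp_coeff_2[of 1] by (simp add: q_def wp_fps_def numeral_eq_Suc)
  hence "fps_nth r 0 = 0"
    by (simp add: r_def p_def wp_fps_def wp_coeff_def numeral_fps_const fps_X_power_mult_nth)
  ultimately have lim: "F \<midarrow>0\<rightarrow> 0" by simp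
  have "F z = 0" if "z \<notin> L" for z
  proof (rule periodic_eq_0[OF _ _ lim that])
    show "F holomorphic_on - L"
      unfolding F_def by (intro holomorphic_intros holomorphic_wp_sum) auto
    show "F (z + w) = F z" if "w \<in> L" for z w
      using that by (simp add: F_def wp_sum_add_period)
  qed
  moreover have "\<forall>\<^sub>F y in at 0. y \<notin> L" using not_islimpt[of 0] by (simp add: islimpt_iff_eventually)
  ultimately have "\<forall>\<^sub>F z in at 0. F z = 0" by (auto elim: eventually_mono)
  hence "(\<lambda>_. 0) has_laurent_expansion fps_to_fls r"
    using exp has_laurent_expansion_cong[of F "\<lambda>_. 0"] by blast
  hence "fps_to_fls r = 0" using has_laurent_expansion_unique has_laurent_expansion_0 by blast
  with \<open>wp_fls L 4 - wp_fls L 2 ^ 2 + fls_const (6 * eisenstein_sum L 4) = fps_to_fls r\<close>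
  show ?thesis by (simp add: algebra_simps)
qed

lemma wp_fls_ode:
  "fls_deriv (fls_deriv (wp_fls L 2)) = 6 * wp_fls L 2 ^ 2 - fls_const (30 * eisenstein_sum L 4)"
proof -
  define c where "c = fls_const (eisenstein_sum L 4)"
  have "fls_const (30 * eisenstein_sum L 4) = 30 * c" "fls_const (6 * eisenstein_sum L 4) = 6 * c"
    unfolding c_def by (metis fls_const_mult_const fls_const_numeral)+
  thus ?thesis unfolding wp_fls_deriv2 wp_fls_4 c_def[symmetric] by (simp only:) simp
qed

text \<open>The candidate \<open>g\<close> may be the series of another lattice or a degenerate
  solution; its coefficient of \<open>z ^ 4\<close> is the only place where \<open>g3\<close>
  enters.\<close>

lemma wp_fls_eqI:
  assumes "fls_subdegree g = -2" "fls_nth g (-2) = 1"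
    and "fls_deriv (fls_deriv g) = 6 * g ^ 2 - fls_const (30 * eisenstein_sum L 4)"
    and "fls_nth g 4 = 5 * eisenstein_sum L 6"
  shows "wp_fls L 2 = g"
proof (rule weierstrass_ode_unique[OF _ _ wp_fls_ode])
  show "fls_nth (wp_fls L 2) 4 = fls_nth g 4"
    using assms wp_coeff_2[of 3] by (simp add: wp_fls_nth)
qed (use assms in \<open>auto simp: subdegree_wp_fls wp_fls_nth\<close>)

lemma countable: "countable L"
proof -
  have "countable (\<Union>n. {l \<in> L. norm l \<le> real n})"
    by (intro countable_UN countable_finite finite_cball countableI_type)
  moreover have "L \<subseteq> (\<Union>n. {l \<in> L. norm l \<le> real n})" using real_arch_simple by blast
  ultimately show ?thesis using countable_subset by blast
qed

lemma wp_sum_pole: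
  assumes "w \<in> L"
  shows "filterlim (wp_sum L 2) at_infinity (at w)"
proof -
  have "filterlim (wp_sum L 2) at_infinity (at 0)"
    by (rule has_laurent_expansion_imp_filterlim_infinity_0[OF wp_sum_has_laurent_expansion])
       (auto simp: subdegree_wp_fls)
  moreover have "(\<lambda>z. wp_sum L 2 (z + w)) = wp_sum L 2"
    using wp_sum_add_period[of 2 w] assms by auto
  ultimately show ?thesis
    by (subst filterlim_at_to_0) simp
qed

text \<open>Removing a countable closed set leaves the plane connected, so agreement near 0
  propagates to all of the complement of \<open>L \<union> M\<close>. At a point of \<open>L\<close>
  outside \<open>M\<close> the function \<open>f\<close> would be continuous while
  \<open>wp_sum L 2\<close> tends to infinity.\<close>

lemma subset_of_continuation:
  assumes M: "closed M" "countable M"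
    and hol: "f holomorphic_on - M"
    and f: "f has_laurent_expansion wp_fls L 2"
  shows "L \<subseteq> M"
proof
  fix w assume w: "w \<in> L"
  show "w \<in> M"
  proof (rule ccontr)
    assume wM: "w \<notin> M"
    define S where "S = - (L \<union> M)"
    have S: "open S" using M(1) closed unfolding S_def by (intro open_Compl closed_Un)
    have "connected S"
      using connected_open_diff_countable[of "UNIV :: complex set" "L \<union> M"] M(2) countable
      by (simp add: S_def Compl_eq_Diff_UNIV connected_UNIV)
    have "\<forall>\<^sub>F z in at 0. f z = wp_sum L 2 z"
      by (rule has_laurent_expansion_imp_eventually_eq[OF f wp_sum_has_laurent_expansion]) auto
    then obtain d where d: "d > 0" "\<And>z. z \<noteq> 0 \<Longrightarrow> dist z 0 < d \<Longrightarrow> f z = wp_sum L 2 z"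
      unfolding eventually_at by blast
    have "uncountable (ball (0 :: complex) d)" using d(1) by (simp add: uncountable_ball)
    hence ne: "ball 0 d \<inter> S \<noteq> {}"
      using countable M(2) countable_subset[of "ball 0 d" "L \<union> M"] by (auto simp: S_def)
    have eq: "f z = wp_sum L 2 z" if "z \<in> S" for z
    proof (rule analytic_continuation_open[of "ball 0 d \<inter> S" S f "wp_sum L 2"])
      show "f z = wp_sum L 2 z" if "z \<in> ball 0 d \<inter> S" for z
        using that d(2)[of z] zero_mem by (auto simp: S_def)
      show "f holomorphic_on S" using hol by (rule holomorphic_on_subset) (auto simp: S_def)
      show "wp_sum L 2 holomorphic_on S"
        using holomorphic_wp_sum[of 2] by (rule holomorphic_on_subset) (auto simp: S_def)
    qed (use S \<open>connected S\<close> ne that in auto)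
    have "isCont f w"
      using holomorphic_on_imp_continuous_on[OF hol] wM M(1)
      by (simp add: continuous_on_eq_continuous_at open_Compl)
    hence "f \<midarrow>w\<rightarrow> f w" by (simp add: isCont_def)
    moreover have "\<forall>\<^sub>F z in at w. f z = wp_sum L 2 z"
    proof -
      have "\<forall>\<^sub>F z in at w. z \<notin> L" using not_islimpt[of w] by (simp add: islimpt_iff_eventually)
      moreover have "\<forall>\<^sub>F z in at w. z \<in> - M"
        by (rule eventually_at_in_open') (use wM M(1) in auto)
      ultimately show ?thesis by eventually_elim (simp add: eq S_def)
    qed
    ultimately have "wp_sum L 2 \<midarrow>w\<rightarrow> f w" by (rule Lim_transform_eventually)
    thus False
      using not_tendsto_and_filterlim_at_infinity[OF _ _ wp_sum_pole[OF w]] by simp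
  qed
qed

end

lemma complex_lattice_eqI:
  assumes "complex_lattice L" "complex_lattice M"
    and "eisenstein_sum L 4 = eisenstein_sum M 4" "eisenstein_sum L 6 = eisenstein_sum M 6"
  shows "L = M"
proof -
  have "L \<subseteq> M" if LM: "complex_lattice L" "complex_lattice M"
      "eisenstein_sum L 4 = eisenstein_sum M 4" "eisenstein_sum L 6 = eisenstein_sum M 6" for L M
  proof -
    interpret L: complex_lattice L by fact
    interpret M: complex_lattice M by fact
    have "wp_fls L 2 = wp_fls M 2"
      using M.wp_fls_ode LM(3,4) wp_coeff_2[of 3]
      by (intro L.wp_fls_eqI) (auto simp: subdegree_wp_fls wp_fls_nth)
    thus ?thesis
      using M.closed M.countable M.holomorphic_wp_sum[of 2] M.wp_sum_has_laurent_expansion[of 2]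
      by (intro L.subset_of_continuation) auto
  qed
  from this[of L M] this[of M L] show ?thesis using assms by auto
qed

section \<open>Nonvanishing of the discriminant\<close>

text \<open>The singly periodic degeneration of the Weierstrass function; subtracting
  \<open>k ^ 2 / 3\<close> removes the constant term.\<close>

definition csc2_fls :: "complex \<Rightarrow> complex fls" where
  "csc2_fls k = (fls_const k * inverse (fps_to_fls (fps_sin k))) ^ 2 - fls_const (k ^ 2 / 3)"

lemma csc2_fls_ode:
  assumes k: "k \<noteq> 0"
  shows "fls_deriv (fls_deriv (csc2_fls k)) = 6 * csc2_fls k ^ 2 - fls_const (2 * k ^ 4 / 3)"
proof -
  define s c w K where "s = fps_to_fls (fps_sin k)" and "c = fps_to_fls (fps_cos k)"
    and "w = inverse s" and "K = fls_const k"
  have "fps_nth (fps_sin k) 1 \<noteq> 0" using k by (simp add: fps_sin_def)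
  hence "s \<noteq> 0" by (metis s_def fps_to_fls_eq_0_iff fps_zero_nth)
  hence ws: "w * s = 1" by (simp add: w_def)
  have s': "fls_deriv s = K * c" and c': "fls_deriv c = - (K * s)"
    by (simp_all add: s_def c_def K_def fls_deriv_fps_to_fls fps_sin_deriv fps_cos_deriv
         fls_times_fps_to_fls fps_const_neg[symmetric] del: fps_const_neg)
  have sc: "c ^ 2 + s ^ 2 = 1"
    using fps_sin_cos_sum_of_squares[of k]
    unfolding s_def c_def by (simp flip: fps_to_fls_power fps_to_fls_plus)
  have "fls_deriv w * s + w * fls_deriv s = 0"
    using arg_cong[OF ws, of fls_deriv] by (simp add: fls_deriv_mult add_ac)
  hence "(fls_deriv w * s + w * fls_deriv s) * w = 0" by simp
  hence w': "fls_deriv w = - (K * w * w * c)"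
    using ws unfolding s' by algebra
  have K': "fls_deriv K = 0" by (simp add: K_def)
  have "fls_deriv (csc2_fls k) = - 2 * K ^ 3 * w ^ 3 * c"
    unfolding csc2_fls_def s_def[symmetric] w_def[symmetric] K_def[symmetric]
    by (simp add: power2_eq_square power3_eq_cube fls_deriv_mult w' K' algebra_simps)
  hence "fls_deriv (fls_deriv (csc2_fls k)) =
      6 * K ^ 4 * w ^ 4 * c ^ 2 + 2 * K ^ 4 * w ^ 3 * s"
    by (simp add: power2_eq_square power3_eq_cube power4_eq_xxxx fls_deriv_mult w' c' K' algebra_simps)
  also have "\<dots> = 6 * K ^ 4 * w ^ 4 - 4 * K ^ 4 * w ^ 2"
    using ws sc by algebra
  also have "\<dots> = 6 * csc2_fls k ^ 2 - fls_const (2 * k ^ 4 / 3)"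
  proof -
    \<comment> \<open>In \<open>6 * ((K * w) ^ 2 - t) ^ 2\<close> the relation
      \<open>3 * t = K ^ 2\<close> turns the cross term into \<open>4 * K ^ 4 * w ^ 2\<close>, and
      the rest is the constant \<open>6 * t ^ 2\<close>.\<close>
    define t where "t = fls_const (k ^ 2 / 3)"
    have t3: "3 * t = K ^ 2"
      unfolding t_def K_def by (simp flip: fls_const_numeral fls_const_power)
    have "fls_const (2 * k ^ 4 / 3) = fls_const (6 * (k ^ 2 / 3) ^ 2)"
      by (simp add: power2_eq_square power4_eq_xxxx mult_ac)
    also have "\<dots> = 6 * t ^ 2"
      unfolding t_def by (simp flip: fls_const_numeral fls_const_power)
    finally have "fls_const (2 * k ^ 4 / 3) = 6 * t ^ 2" .
    moreover have "csc2_fls k = (K * w) ^ 2 - t"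
      by (simp add: csc2_fls_def s_def w_def K_def t_def)
    ultimately show ?thesis using t3 by algebra
  qed
  finally show ?thesis .
qed

lemma fps_mult_nth_upto:
  fixes f g :: "complex fps"
  shows "fps_nth (f * g) 2 = fps_nth f 0 * fps_nth g 2 + fps_nth f 1 * fps_nth g 1 + fps_nth f 2 * fps_nth g 0"
    and "fps_nth (f * g) 3 = fps_nth f 0 * fps_nth g 3 + fps_nth f 1 * fps_nth g 2 +
           fps_nth f 2 * fps_nth g 1 + fps_nth f 3 * fps_nth g 0"
    and "fps_nth (f * g) 4 = fps_nth f 0 * fps_nth g 4 + fps_nth f 1 * fps_nth g 3 +
           fps_nth f 2 * fps_nth g 2 + fps_nth f 3 * fps_nth g 1 + fps_nth f 4 * fps_nth g 0"
    and "fps_nth (f * g) 5 = fps_nth f 0 * fps_nth g 5 + fps_nth f 1 * fps_nth g 4 +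
           fps_nth f 2 * fps_nth g 3 + fps_nth f 3 * fps_nth g 2 + fps_nth f 4 * fps_nth g 1 +
           fps_nth f 5 * fps_nth g 0"
    and "fps_nth (f * g) 6 = fps_nth f 0 * fps_nth g 6 + fps_nth f 1 * fps_nth g 5 +
           fps_nth f 2 * fps_nth g 4 + fps_nth f 3 * fps_nth g 3 + fps_nth f 4 * fps_nth g 2 +
           fps_nth f 5 * fps_nth g 1 + fps_nth f 6 * fps_nth g 0"
  by (simp_all add: fps_mult_nth eval_nat_numeral)

text \<open>With \<open>v = sin (k * z) / (k * z)\<close> and \<open>t = 1 / v\<close>, the series
  is \<open>t ^ 2 / z ^ 2\<close> minus a constant, so the coefficient sought is that of
  \<open>z ^ 6\<close> in \<open>t ^ 2\<close>; the coefficients of \<open>t\<close> are solved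
  recursively from \<open>v * t = 1\<close>.\<close>

lemma csc2_fls_nth:
  assumes k: "k \<noteq> 0"
  shows "fls_subdegree (csc2_fls k) = -2" "fls_nth (csc2_fls k) (-2) = 1"
    "fls_nth (csc2_fls k) 4 = 2 * k ^ 6 / 189"
proof -
  define v where "v = fps_const (1 / k) * fps_shift 1 (fps_sin k)"
  define t where "t = inverse v"
  have v_nth: "fps_nth v n = (if even n then (- 1) ^ (n div 2) * k ^ n / fact (Suc n) else 0)" for n
    using k by (simp add: v_def fps_sin_def) (simp add: algebra_simps)
  have v: "fps_nth v 0 = 1" "fps_nth v 1 = 0" "fps_nth v 2 = - (k ^ 2 / 6)" "fps_nth v 3 = 0"
    "fps_nth v 4 = k ^ 4 / 120" "fps_nth v 5 = 0" "fps_nth v 6 = - (k ^ 6 / 5040)"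
    unfolding v_nth by (simp_all add: fact_numeral)
  have vt: "fps_nth (v * t) n = (if n = 0 then 1 else 0)" for n
    using v(1) by (simp add: t_def inverse_mult_eq_1')
  note nth = fps_mult_nth_1 fps_mult_nth_upto
  have t0: "fps_nth t 0 = 1" using v(1) by (simp add: t_def)
  have t1: "fps_nth t 1 = 0" using vt[of 1] v(1,2) t0 by (simp add: nth)
  have "fps_nth t 2 + fps_nth v 2 = 0" using vt[of 2] v(1,2) t0 t1 by (simp add: nth)
  hence t2: "fps_nth t 2 = k ^ 2 / 6" unfolding v by simp
  have t3: "fps_nth t 3 = 0" using vt[of 3] v(1,2,4) t0 t1 by (simp add: nth)
  have "fps_nth t 4 + fps_nth v 2 * fps_nth t 2 + fps_nth v 4 = 0"
    using vt[of 4] v(1,2,4) t0 t1 t3 by (simp add: nth)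
  hence "fps_nth t 4 = - (fps_nth v 2 * fps_nth t 2) - fps_nth v 4" by algebra
  also have "\<dots> = 7 * k ^ 4 / 360" unfolding v t2 by (simp add: power2_eq_square power4_eq_xxxx)
  finally have t4: "fps_nth t 4 = 7 * k ^ 4 / 360" .
  have t5: "fps_nth t 5 = 0" using vt[of 5] v(1,2,4,6) t0 t1 t3 by (simp add: nth)
  have k6: "k ^ 6 = k ^ 2 * k ^ 4" by (simp flip: power_add)
  have "fps_nth t 6 + fps_nth v 2 * fps_nth t 4 + fps_nth v 4 * fps_nth t 2 + fps_nth v 6 = 0"
    using vt[of 6] v(1,2,4,6) t0 t1 t3 t5 by (simp add: nth)
  hence "fps_nth t 6 = - (fps_nth v 2 * fps_nth t 4) - fps_nth v 4 * fps_nth t 2 - fps_nth v 6"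
    by algebra
  also have "\<dots> = 31 * k ^ 6 / 15120" unfolding v t2 t4 k6 by simp
  finally have t6: "fps_nth t 6 = 31 * k ^ 6 / 15120" .
  have "fps_nth (t ^ 2) 6 = 2 * (fps_nth t 6 + fps_nth t 2 * fps_nth t 4)"
    unfolding power2_eq_square using t0 t1 t3 t5 by (simp add: nth)
  also have "\<dots> = 2 * k ^ 6 / 189" unfolding t2 t4 t6 k6 by simp
  finally have t2_6: "fps_nth (t ^ 2) 6 = 2 * k ^ 6 / 189" .
  have "fps_sin k = fps_const k * fps_X * v"
  proof (rule fps_ext)
    fix n show "fps_nth (fps_sin k) n = fps_nth (fps_const k * fps_X * v) n"
      using k by (cases n) (simp_all add: v_def mult.assoc fps_sin_def)
  qed
  hence "fps_to_fls (fps_sin k) = fls_const k * fls_X * fps_to_fls v"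
    by (simp add: fls_times_fps_to_fls)
  moreover have "fps_to_fls v * fps_to_fls t = 1"
  proof -
    have "v * t = 1" using vt by (intro fps_ext) simp
    thus ?thesis by (metis fls_times_fps_to_fls fps_one_to_fls)
  qed
  hence "inverse (fps_to_fls v) = fps_to_fls t" by (metis inverse_unique)
  ultimately have "fls_const k * inverse (fps_to_fls (fps_sin k)) = fls_X_inv * fps_to_fls t"
    using k by (simp add: fls_inverse_X mult_ac fls_const_nonzero)
  hence eq: "csc2_fls k = fls_shift 2 (fps_to_fls (t ^ 2)) - fls_const (k ^ 2 / 3)"
    by (simp add: csc2_fls_def power_mult_distrib fps_to_fls_power fls_X_inv_power_times_conv_shift)
  show "fls_nth (csc2_fls k) (-2) = 1" "fls_nth (csc2_fls k) 4 = 2 * k ^ 6 / 189"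
    using t0 t2_6 by (simp_all add: eq power2_eq_square)
  show "fls_subdegree (csc2_fls k) = -2"
    by (rule fls_subdegree_eqI) (use t0 in \<open>auto simp: eq power2_eq_square\<close>)
qed

lemma csc2_has_laurent_expansion:
  "(\<lambda>z. (k * inverse (sin (k * z))) ^ 2 - k ^ 2 / 3) has_laurent_expansion csc2_fls k"
  unfolding csc2_fls_def
  by (intro laurent_expansion_intros has_laurent_expansion_fps has_fps_expansion_sin)

context complex_lattice
begin

lemma not_collinear:
  assumes "k \<noteq> 0" "L \<subseteq> {z. Im (k * z) = 0}"
  shows False
proof -
  obtain R where R: "\<And>z. \<exists>l\<in>L. norm (z - l) \<le> R" using cocompact by blast
  \<comment> \<open>Chosen so that \<open>Im (k * z) = norm k * (R + 1)\<close>, which puts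
    \<open>z\<close> at distance \<open>R + 1\<close> from the line.\<close>
  define z where "z = \<i> * of_real (norm k * (R + 1)) / k"
  obtain l where l: "l \<in> L" "norm (z - l) \<le> R" using R by blast
  have "norm k * (R + 1) = Im (k * z - k * l)"
    using l(1) assms by (auto simp: z_def)
  also have "\<dots> \<le> norm (k * (z - l))" by (metis abs_Im_le_cmod abs_le_D1 right_diff_distrib)
  also have "\<dots> = norm k * norm (z - l)" by (simp add: norm_mult)
  also have "\<dots> \<le> norm k * R" using l(2) by (intro mult_left_mono) auto
  finally show False using assms(1) by (simp add: algebra_simps)
qed

text \<open>If the discriminant vanished, the Laurent expansion at 0 would be that of
  \<open>k\<^sup>2 / sin\<^sup>2 (k z) - k\<^sup>2 / 3\<close> for some \<open>k\<close>, or of \<open>1 / z\<^sup>2\<close>; but these functions have all their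
  poles on one line.\<close>

lemma discriminant_nonzero:
  "(60 * eisenstein_sum L 4) ^ 3 \<noteq> 27 * (140 * eisenstein_sum L 6) ^ 2"
proof
  define a b where "a = eisenstein_sum L 4" and "b = eisenstein_sum L 6"
  assume "(60 * eisenstein_sum L 4) ^ 3 = 27 * (140 * eisenstein_sum L 6) ^ 2"
  hence disc: "20 * a ^ 3 = 49 * b ^ 2"
    by (simp add: a_def b_def power_mult_distrib)
  show False
  proof (cases "a = 0")
    case True
    hence "b = 0" using disc by simp
    have "wp_fls L 2 = fls_X_inv ^ 2"
    proof (rule wp_fls_eqI)
      show "fls_deriv (fls_deriv (fls_X_inv ^ 2)) =
          6 * (fls_X_inv ^ 2) ^ 2 - fls_const (30 * eisenstein_sum L 4)"
        using True by (simp add: a_def power2_eq_square fls_deriv_mult algebra_simps)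
    qed (use \<open>b = 0\<close> in \<open>auto simp: b_def fls_X_inv_power_nth fls_subdegree_pow\<close>)
    moreover have "(\<lambda>z :: complex. inverse z ^ 2) has_laurent_expansion fls_X_inv ^ 2"
      using has_laurent_expansion_power[OF has_laurent_expansion_inverse[OF has_laurent_expansion_fps_X]]
      by (simp add: fls_inverse_X)
    ultimately have "L \<subseteq> {0}"
      by (intro subset_of_continuation[where f = "\<lambda>z. inverse z ^ 2"])
         (auto intro!: holomorphic_intros)
    hence "L \<subseteq> {z. Im (1 * z) = 0}" by auto
    thus False by (rule not_collinear[of 1, OF one_neq_zero])
  next
    case False
    \<comment> \<open>Matching the equation needs \<open>k ^ 4 = 45 * a\<close>, matching the
      coefficient of \<open>z ^ 4\<close> needs \<open>2 * k ^ 6 = 945 * b\<close>. The quotient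
      gives \<open>k ^ 2\<close>, and \<open>disc\<close> is exactly the compatibility of the
      two.\<close>
    define k where "k = csqrt (21 * b / (2 * a))"
    have k2: "k ^ 2 = 21 * b / (2 * a)" by (simp add: k_def)
    have "b \<noteq> 0" using disc False by auto
    hence k: "k \<noteq> 0" using False by (simp add: k_def)
    have "k ^ 4 = (k ^ 2) ^ 2" by simp
    also have "\<dots> = 45 * a"
      unfolding k2 using disc False by (simp add: field_simps) algebra
    finally have k4: "k ^ 4 = 45 * a" .
    have "k ^ 6 = k ^ 4 * k ^ 2" by (simp flip: power_add)
    hence k6: "2 * k ^ 6 / 189 = 5 * b"
      unfolding k4 k2 using False by (simp add: field_simps)
    have "wp_fls L 2 = csc2_fls k"
      using csc2_fls_nth[OF k] csc2_fls_ode[OF k] k4 k6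
      by (intro wp_fls_eqI) (auto simp: a_def b_def)
    moreover define M where "M = {z. sin (k * z) = 0}"
    have "countable M"
    proof -
      have "M \<subseteq> range (\<lambda>n. of_int n * of_real pi / k)"
        using k by (auto simp: M_def sin_eq_0 field_simps)
      thus ?thesis by (rule countable_subset) simp
    qed
    moreover have "closed M" unfolding M_def by (intro closed_Collect_eq continuous_intros)
    ultimately have "L \<subseteq> M"
      using csc2_has_laurent_expansion[of k]
      by (intro subset_of_continuation[where f = "\<lambda>z. (k * inverse (sin (k * z))) ^ 2 - k ^ 2 / 3"])
         (auto simp: M_def intro!: holomorphic_intros)
    also have "M \<subseteq> {z. Im (k * z) = 0}"
    proof clarify
      fix z assume "z \<in> M"
      then obtain n where "k * z = of_int n * of_real pi" by (auto simp: M_def sin_eq_0)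
      hence "Im (k * z) = Im (of_int n * of_real pi)" by (rule arg_cong)
      thus "Im (k * z) = 0" by simp
    qed
    finally show False using not_collinear[OF k] by simp
  qed
qed

end

section \<open>The modular invariant and homothety\<close>

lemma zlattice_altdef: "zlattice w1 w2 = (\<lambda>(m, n). of_int m * w1 + of_int n * w2) ` UNIV"
  by (auto simp: zlattice_def image_iff)

lemma zlattice_commute: "zlattice w1 w2 = zlattice w2 w1"
  by (auto simp: zlattice_def) (metis add.commute)+

lemma zlattice_scale: "(*) c ` zlattice w1 w2 = zlattice (c * w1) (c * w2)"
proof -
  have "c * (of_int m * w1 + of_int n * w2) = of_int m * (c * w1) + of_int n * (c * w2)" for m n
    by (simp add: algebra_simps)
  thus ?thesis by (auto simp: zlattice_altdef image_image case_prod_unfold)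
qed

lemma zlattice_memI: "z = of_int m * w1 + of_int n * w2 \<Longrightarrow> z \<in> zlattice w1 w2"
  by (auto simp: zlattice_def)

lemma zlattice_subsetI:
  assumes "w1 \<in> zlattice v1 v2" "w2 \<in> zlattice v1 v2"
  shows "zlattice w1 w2 \<subseteq> zlattice v1 v2"
proof
  fix z assume "z \<in> zlattice w1 w2"
  then obtain m n where z: "z = of_int m * w1 + of_int n * w2" by (auto simp: zlattice_def)
  obtain a b where w1: "w1 = of_int a * v1 + of_int b * v2" using assms(1) by (auto simp: zlattice_def)
  obtain c d where w2: "w2 = of_int c * v1 + of_int d * v2" using assms(2) by (auto simp: zlattice_def)
  have "z = of_int (m * a + n * c) * v1 + of_int (m * b + n * d) * v2"
    unfolding z w1 w2 by (simp add: algebra_simps)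
  thus "z \<in> zlattice v1 v2" by (rule zlattice_memI)
qed

lemma zlattice_basis: "w1 \<in> zlattice w1 w2" "w2 \<in> zlattice w1 w2"
  using zlattice_memI[of w1 1 w1 0 w2] zlattice_memI[of w2 0 w1 1 w2] by auto

text \<open>The exponent is half of 3: the sum over the lattice is dominated by a product of two
  such sums, each convergent because 3/2 exceeds 1.\<close>

lemma summable_on_int_powr: "(\<lambda>m :: int. (1 + \<bar>real_of_int m\<bar>) powr (- 3 / 2)) summable_on UNIV"
proof -
  define f where "f = (\<lambda>m :: int. (1 + \<bar>real_of_int m\<bar>) powr (- 3 / 2))"
  have "summable (\<lambda>n. real n powr (- 3 / 2))" by (subst summable_real_powr_iff) auto
  hence "summable (\<lambda>n. real (Suc n) powr (- 3 / 2))" by (subst summable_Suc_iff)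
  hence nat: "(\<lambda>n. (1 + real n) powr (- 3 / 2)) summable_on UNIV"
    by (subst summable_on_UNIV_nonneg_real_iff) auto
  have "f summable_on range int"
    by (subst summable_on_reindex) (use nat in \<open>auto simp: f_def o_def\<close>)
  moreover have "f summable_on range (\<lambda>n. - int n)"
    by (subst summable_on_reindex) (use nat in \<open>auto simp: f_def o_def inj_def\<close>)
  ultimately have "f summable_on range int \<union> range (\<lambda>n. - int n)" by (rule summable_on_union)
  moreover have "m \<in> range int \<union> range (\<lambda>n. - int n)" for m
    by (cases m rule: int_cases2) auto
  hence "range int \<union> range (\<lambda>n. - int n) = UNIV" by blast
  ultimately show ?thesis by (simp add: f_def)
qed

context
  fixes w1 w2 :: complex
  assumes basis: "Im (w1 / w2) > 0"
begin

lemma zlattice_norm_ge: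
  obtains c where "c > 0"
    "\<And>m n. norm (of_int m * w1 + of_int n * w2) \<ge> c * (\<bar>real_of_int m\<bar> + \<bar>real_of_int n\<bar>)"
proof -
  define t where "t = w1 / w2"
  have w2: "w2 \<noteq> 0" using basis by auto
  have y: "Im t > 0" using basis by (simp add: t_def)
  \<comment> \<open>For \<open>z = m * t + n\<close>, the imaginary part bounds \<open>m\<close> by
    \<open>norm z / Im t\<close>, and then \<open>n = z - m * t\<close> is bounded by
    \<open>norm z * (1 + norm t / Im t)\<close>.\<close>
  define K where "K = 1 / Im t + 1 + norm t / Im t"
  have K: "K > 0" using y by (auto simp: K_def intro!: add_pos_nonneg)
  have "norm (of_int m * w1 + of_int n * w2) \<ge> (norm w2 / K) * (\<bar>real_of_int m\<bar> + \<bar>real_of_int n\<bar>)"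
    for m n
  proof -
    define z where "z = of_int m * t + of_int n"
    have "\<bar>real_of_int m\<bar> * Im t = \<bar>Im z\<bar>" using y by (simp add: z_def abs_mult)
    also have "\<dots> \<le> norm z" by (rule abs_Im_le_cmod)
    finally have m: "\<bar>real_of_int m\<bar> \<le> norm z / Im t" using y by (simp add: field_simps)
    have "\<bar>real_of_int n\<bar> = norm (z - of_int m * t)" by (simp add: z_def)
    also have "\<dots> \<le> norm z + norm (of_int m * t)" by (rule norm_triangle_ineq4)
    also have "norm (of_int m * t) = \<bar>real_of_int m\<bar> * norm t" by (simp add: norm_mult)
    also have "\<dots> \<le> norm z / Im t * norm t" using m by (rule mult_right_mono) simp
    finally have "\<bar>real_of_int m\<bar> + \<bar>real_of_int n\<bar> \<le> K * norm z"
      using m by (simp add: K_def algebra_simps)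
    hence "\<bar>real_of_int m\<bar> + \<bar>real_of_int n\<bar> \<le> K * (norm (of_int m * w1 + of_int n * w2) / norm w2)"
    proof -
      have "of_int m * w1 + of_int n * w2 = w2 * z" using w2 by (simp add: z_def t_def field_simps)
      hence "norm (of_int m * w1 + of_int n * w2) / norm w2 = norm z" using w2 by (simp add: norm_mult)
      thus ?thesis using \<open>\<bar>real_of_int m\<bar> + \<bar>real_of_int n\<bar> \<le> K * norm z\<close> by simp
    qed
    thus ?thesis using K w2 by (simp add: field_simps)
  qed
  moreover have "norm w2 / K > 0" using K w2 by simp
  ultimately show ?thesis using that by blast
qed

lemma zlattice_eq_0_iff: "of_int m * w1 + of_int n * w2 = 0 \<longleftrightarrow> m = 0 \<and> n = 0"
proof
  assume eq: "of_int m * w1 + of_int n * w2 = 0"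
  obtain c where "c > 0" "c * (\<bar>real_of_int m\<bar> + \<bar>real_of_int n\<bar>) \<le> norm (of_int m * w1 + of_int n * w2)"
    using zlattice_norm_ge by metis
  hence "\<bar>real_of_int m\<bar> + \<bar>real_of_int n\<bar> \<le> 0"
    unfolding eq norm_zero by (metis mult_le_0_iff not_less)
  hence "\<bar>real_of_int m\<bar> = 0" "\<bar>real_of_int n\<bar> = 0" by linarith+
  thus "m = 0 \<and> n = 0" by simp
qed auto

lemma zlattice_inj: "inj (\<lambda>(m, n). of_int m * w1 + of_int n * w2)"
proof (rule injI, clarify)
  fix m n m' n'
  assume "of_int m * w1 + of_int n * w2 = of_int m' * w1 + of_int n' * w2"
  hence "of_int (m - m') * w1 + of_int (n - n') * w2 = 0" by (simp add: algebra_simps)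
  thus "m = m' \<and> n = n'" unfolding zlattice_eq_0_iff by simp
qed

lemma complex_lattice_zlattice: "complex_lattice (zlattice w1 w2)"
proof
  show "0 \<in> zlattice w1 w2" by (rule zlattice_memI[of _ 0 _ 0]) simp
  show "x - y \<in> zlattice w1 w2" if x: "x \<in> zlattice w1 w2" and y: "y \<in> zlattice w1 w2" for x y
  proof -
    obtain a b where "x = of_int a * w1 + of_int b * w2" using x by (auto simp: zlattice_def)
    moreover obtain c d where "y = of_int c * w1 + of_int d * w2" using y by (auto simp: zlattice_def)
    ultimately show ?thesis by (intro zlattice_memI[of _ "a - c" _ "b - d"]) (simp add: algebra_simps)
  qed
  show "(\<lambda>l. 1 / norm l ^ 3) summable_on zlattice w1 w2"
  proof -
    obtain c where c: "c > 0"
      "\<And>m n. norm (of_int m * w1 + of_int n * w2) \<ge> c * (\<bar>real_of_int m\<bar> + \<bar>real_of_int n\<bar>)"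
      using zlattice_norm_ge by blast
    define a where "a = (\<lambda>m :: int. (1 + \<bar>real_of_int m\<bar>) powr (- 3 / 2))"
    have a: "a summable_on UNIV" unfolding a_def by (rule summable_on_int_powr)
    have "(\<lambda>(m, n). 8 / c ^ 3 * a m * a n) summable_on UNIV \<times> UNIV"
    proof (rule summable_on_SigmaI)
      show "((\<lambda>n. case (m, n) of (m, n) \<Rightarrow> 8 / c ^ 3 * a m * a n) has_sum
              8 / c ^ 3 * a m * infsum a UNIV) UNIV" for m
        unfolding case_prod_conv by (intro has_sum_cmult_right has_sum_infsum a)
      show "(\<lambda>m. 8 / c ^ 3 * a m * infsum a UNIV) summable_on UNIV"
        by (intro summable_on_cmult_left summable_on_cmult_right a)
    qed (use c(1) in \<open>auto simp: a_def\<close>)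
    hence "(\<lambda>(m, n). 1 / norm (of_int m * w1 + of_int n * w2) ^ 3) summable_on UNIV \<times> UNIV"
    proof (rule summable_on_comparison_test)
      fix p :: "int \<times> int"
      obtain m n where p: "p = (m, n)" by (cases p)
      define s where "s = \<bar>real_of_int m\<bar> + \<bar>real_of_int n\<bar>"
      show "(case p of (m, n) \<Rightarrow> 1 / norm (of_int m * w1 + of_int n * w2) ^ 3) \<le>
              (case p of (m, n) \<Rightarrow> 8 / c ^ 3 * a m * a n)"
      proof (cases "m = 0 \<and> n = 0")
        case True
        thus ?thesis using c(1) by (simp add: p a_def)
      next
        case False
        hence "\<bar>m\<bar> + \<bar>n\<bar> \<ge> 1" by linarith
        hence "real_of_int (\<bar>m\<bar> + \<bar>n\<bar>) \<ge> 1" by linarith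
        hence s: "s \<ge> 1" by (simp add: s_def)
        \<comment> \<open>Both factors are at most \<open>2 * s\<close> since
          \<open>s \<ge> 1\<close>; the power -3/2 turns their product bound into
          \<open>1 / (8 * s ^ 3)\<close>, whence the factor 8.\<close>
        have "(1 + \<bar>real_of_int m\<bar>) * (1 + \<bar>real_of_int n\<bar>) \<le> (2 * s) * (2 * s)"
          using s by (intro mult_mono) (auto simp: s_def)
        hence "((2 * s) * (2 * s)) powr (- 3 / 2) \<le>
                 ((1 + \<bar>real_of_int m\<bar>) * (1 + \<bar>real_of_int n\<bar>)) powr (- 3 / 2)"
          by (intro powr_mono2') (auto intro!: mult_pos_pos)
        also have "\<dots> = a m * a n" by (simp add: a_def powr_mult)
        also have "((2 * s) * (2 * s)) powr (- 3 / 2) = (2 * s) powr (- 3)"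
        proof -
          have "(2 * s) * (2 * s) = (2 * s) powr 2" using s by (simp add: powr_numeral power2_eq_square)
          thus ?thesis by (simp add: powr_powr)
        qed
        also have "\<dots> = 1 / (8 * s ^ 3)"
          using s by (simp add: powr_minus powr_numeral power_mult_distrib field_simps)
        finally have "1 / s ^ 3 \<le> 8 * (a m * a n)" by simp
        hence "1 / s ^ 3 / c ^ 3 \<le> 8 * (a m * a n) / c ^ 3"
          using c(1) by (intro divide_right_mono) auto
        moreover have "1 / norm (of_int m * w1 + of_int n * w2) ^ 3 \<le> 1 / (c * s) ^ 3"
        proof (intro divide_left_mono power_mono mult_pos_pos zero_less_power)
          show "c * s \<le> norm (of_int m * w1 + of_int n * w2)" using c(2)[of m n] by (simp add: s_def)
          moreover have "c * s > 0" using c(1) s by simp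
          ultimately show "norm (of_int m * w1 + of_int n * w2) > 0" by linarith
        qed (use c(1) s in auto)
        ultimately show ?thesis by (simp add: p power_mult_distrib mult_ac)
      qed
    qed auto
    thus ?thesis
      unfolding zlattice_altdef by (subst summable_on_reindex[OF zlattice_inj])
        (simp add: o_def case_prod_unfold)
  qed
  show "\<exists>R. \<forall>z. \<exists>l\<in>zlattice w1 w2. norm (z - l) \<le> R"
  proof (intro exI[of _ "norm w1 + norm w2"] allI)
    fix z
    define t where "t = w1 / w2"
    have w2: "w2 \<noteq> 0" using basis by auto
    have y: "Im t > 0" using basis by (simp add: t_def)
    define a b where "a = Im (z / w2) / Im t" and "b = Re (z / w2) - a * Re t"
    have "z / w2 = of_real a * t + of_real b"
      using y by (simp add: complex_eq_iff a_def b_def)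
    hence z: "z = of_real a * w1 + of_real b * w2"
      using w2 by (simp add: t_def field_simps)
    define l where "l = of_int \<lfloor>a\<rfloor> * w1 + of_int \<lfloor>b\<rfloor> * w2"
    have "z - l = of_real (frac a) * w1 + of_real (frac b) * w2"
      by (simp add: z l_def frac_def algebra_simps)
    also have "norm \<dots> \<le> frac a * norm w1 + frac b * norm w2"
      by (rule order_trans[OF norm_triangle_ineq]) (simp add: norm_mult)
    also have "\<dots> \<le> 1 * norm w1 + 1 * norm w2"
      using frac_lt_1[of a] frac_lt_1[of b] by (intro add_mono mult_right_mono) auto
    finally show "\<exists>l\<in>zlattice w1 w2. norm (z - l) \<le> norm w1 + norm w2"
      using zlattice_memI[OF l_def] by auto
  qed
qed

lemma eisenstein_G_eq:
  assumes "k > 0"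
  shows "eisenstein_G k (w1 / w2) = w2 ^ k * eisenstein_sum (zlattice w1 w2) k"
proof -
  have w2: "w2 \<noteq> 0" using basis by auto
  have "eisenstein_sum (zlattice w1 w2) k =
          infsum (\<lambda>(m, n). 1 / (of_int m * w1 + of_int n * w2) ^ k) UNIV"
    unfolding eisenstein_sum_def zlattice_altdef
    by (subst infsum_reindex[OF zlattice_inj]) (simp add: o_def case_prod_unfold)
  also have "\<dots> = infsum (\<lambda>(m, n). 1 / (of_int m * w1 + of_int n * w2) ^ k) (UNIV - {(0, 0)})"
    using assms by (intro infsum_cong_neutral) auto
  also have "w2 ^ k * \<dots> =
      infsum (\<lambda>p. w2 ^ k * (case p of (m, n) \<Rightarrow> 1 / (of_int m * w1 + of_int n * w2) ^ k)) (UNIV - {(0, 0)})"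
    by (rule infsum_cmult_right'[symmetric])
  also have "\<dots> = eisenstein_G k (w1 / w2)"
    unfolding eisenstein_G_def
  proof (rule infsum_cong)
    fix p :: "int \<times> int"
    obtain m n where p: "p = (m, n)" by (cases p)
    have "of_int m * w1 + of_int n * w2 = w2 * (of_int m * (w1 / w2) + of_int n)"
      using w2 by (simp add: field_simps)
    thus "w2 ^ k * (case p of (m, n) \<Rightarrow> 1 / (of_int m * w1 + of_int n * w2) ^ k) =
            (case p of (m, n) \<Rightarrow> 1 / (of_int m * (w1 / w2) + of_int n) ^ k)"
      using w2 by (simp add: p power_mult_distrib)
  qed
  finally show ?thesis by simp
qed

end

section \<open>The invariant as a function of the lattice alone, and its injectivity up to
  scaling\<close>

definition eisenstein_J :: "complex set \<Rightarrow> complex" where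
  "eisenstein_J L = 1728 * (60 * eisenstein_sum L 4) ^ 3 /
     ((60 * eisenstein_sum L 4) ^ 3 - 27 * (140 * eisenstein_sum L 6) ^ 2)"

text \<open>Numerator and denominator both have weight 12. This serves the passage from
  \<open>w1 / w2\<close> to the lattice as well as scaling invariance.\<close>

lemma homogeneous_quotient:
  fixes u a b :: complex
  assumes "u \<noteq> 0"
  shows "1728 * (60 * (u ^ 4 * a)) ^ 3 / ((60 * (u ^ 4 * a)) ^ 3 - 27 * (140 * (u ^ 6 * b)) ^ 2) =
         1728 * (60 * a) ^ 3 / ((60 * a) ^ 3 - 27 * (140 * b) ^ 2)"
proof -
  have "(60 * (u ^ 4 * a)) ^ 3 = u ^ 12 * (60 * a) ^ 3" "(140 * (u ^ 6 * b)) ^ 2 = u ^ 12 * (140 * b) ^ 2"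
    by (simp_all add: power_mult_distrib flip: power_mult)
  moreover have "1728 * (u ^ 12 * x) / (u ^ 12 * x - 27 * (u ^ 12 * y)) = 1728 * x / (x - 27 * y)" for x y
  proof -
    have "1728 * (u ^ 12 * x) / (u ^ 12 * x - 27 * (u ^ 12 * y)) =
            (u ^ 12 * (1728 * x)) / (u ^ 12 * (x - 27 * y))"
      by (simp add: algebra_simps)
    thus ?thesis using assms by simp
  qed
  ultimately show ?thesis by (simp only:)
qed

lemma modular_J_eq:
  assumes "Im (w1 / w2) > 0"
  shows "modular_J (w1 / w2) = eisenstein_J (zlattice w1 w2)"
proof -
  have G: "eisenstein_G 4 (w1 / w2) = w2 ^ 4 * eisenstein_sum (zlattice w1 w2) 4"
    "eisenstein_G 6 (w1 / w2) = w2 ^ 6 * eisenstein_sum (zlattice w1 w2) 6"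
    using assms by (simp_all add: eisenstein_G_eq)
  show ?thesis
    unfolding modular_J_def modular_g2_def modular_g3_def eisenstein_J_def G
    by (rule homogeneous_quotient) (use assms in auto)
qed

lemma lattice_J_eq:
  assumes "Im (w1 / w2) > 0"
  shows "lattice_J (zlattice w1 w2) = eisenstein_J (zlattice w1 w2)"
  unfolding lattice_J_def
proof (rule the_equality)
  show "\<exists>\<beta>1 \<beta>2. Im (\<beta>1 / \<beta>2) > 0 \<and> zlattice w1 w2 = zlattice \<beta>1 \<beta>2 \<and>
          eisenstein_J (zlattice w1 w2) = modular_J (\<beta>1 / \<beta>2)"
    using assms by (intro exI[of _ w1] exI[of _ w2]) (simp add: modular_J_eq)
  fix j assume "\<exists>\<beta>1 \<beta>2. Im (\<beta>1 / \<beta>2) > 0 \<and> zlattice w1 w2 = zlattice \<beta>1 \<beta>2 \<and>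
          j = modular_J (\<beta>1 / \<beta>2)"
  thus "j = eisenstein_J (zlattice w1 w2)"
    by (elim exE conjE) (simp only: modular_J_eq)
qed

lemma eisenstein_sum_scale:
  assumes "c \<noteq> 0"
  shows "eisenstein_sum ((*) c ` L) k = (1 / c) ^ k * eisenstein_sum L k"
proof -
  have "inj_on ((*) c) L" using assms by (auto simp: inj_on_def)
  hence "eisenstein_sum ((*) c ` L) k = infsum (\<lambda>l. (1 / c) ^ k * (1 / l ^ k)) L"
    unfolding eisenstein_sum_def
    by (subst infsum_reindex) (auto simp: o_def power_mult_distrib power_divide)
  thus ?thesis by (simp only: infsum_cmult_right' eisenstein_sum_def)
qed

lemma eisenstein_J_scale:
  assumes "c \<noteq> 0"
  shows "eisenstein_J ((*) c ` L) = eisenstein_J L"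
  unfolding eisenstein_J_def eisenstein_sum_scale[OF assms]
  by (rule homogeneous_quotient) (use assms in simp)

definition homothetic :: "complex set \<Rightarrow> complex set \<Rightarrow> bool" where
  "homothetic L M \<longleftrightarrow> (\<exists>c. c \<noteq> 0 \<and> M = (*) c ` L)"

text \<open>Cross-multiplying leaves \<open>a ^ 3 * b' ^ 2 = a' ^ 3 * b ^ 2\<close>. If
  \<open>a\<close> or \<open>b\<close> is zero, a sixth or fourth root does; otherwise
  \<open>c ^ 2\<close> must be the quotient of \<open>b / b'\<close> by \<open>a / a'\<close>, and
  the relation yields \<open>c ^ 4 = a / a'\<close>. The discriminants exclude that \<open>a\<close>
  and \<open>b\<close>, or \<open>a'\<close> and \<open>b'\<close>, vanish together.\<close>

lemma eisenstein_scaling_exists: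
  fixes a b a' b' :: complex
  assumes "(60 * a) ^ 3 \<noteq> 27 * (140 * b) ^ 2" "(60 * a') ^ 3 \<noteq> 27 * (140 * b') ^ 2"
    and "1728 * (60 * a) ^ 3 / ((60 * a) ^ 3 - 27 * (140 * b) ^ 2) =
         1728 * (60 * a') ^ 3 / ((60 * a') ^ 3 - 27 * (140 * b') ^ 2)"
  obtains c where "c \<noteq> 0" "a = c ^ 4 * a'" "b = c ^ 6 * b'"
proof -
  have "1728 * (60 * a) ^ 3 * ((60 * a') ^ 3 - 27 * (140 * b') ^ 2) =
        1728 * (60 * a') ^ 3 * ((60 * a) ^ 3 - 27 * (140 * b) ^ 2)"
    using assms by (simp add: frac_eq_eq)
  hence eq: "a ^ 3 * b' ^ 2 = a' ^ 3 * b ^ 2"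
    by (simp add: power_mult_distrib algebra_simps)
  consider "a = 0" | "b = 0" "a \<noteq> 0" | "a \<noteq> 0" "b \<noteq> 0" by blast
  thus ?thesis
  proof cases
    case 1
    with assms(1) eq have 0: "b \<noteq> 0" "a' = 0" by auto
    with assms(2) have "b' \<noteq> 0" by auto
    obtain c where c: "c ^ 6 = b / b'" by (metis exists_complex_root zero_neq_numeral)
    have "c \<noteq> 0" using c 0 \<open>b' \<noteq> 0\<close> by auto
    thus ?thesis using that[of c] 1 0 \<open>b' \<noteq> 0\<close> c by simp
  next
    case 2
    with eq have 0: "b' = 0" by auto
    with assms(2) have "a' \<noteq> 0" by auto
    obtain c where c: "c ^ 4 = a / a'" by (metis exists_complex_root zero_neq_numeral)
    have "c \<noteq> 0" using c 2 \<open>a' \<noteq> 0\<close> by auto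
    thus ?thesis using that[of c] 2 0 \<open>a' \<noteq> 0\<close> c by simp
  next
    case 3
    have 0: "a' \<noteq> 0" "b' \<noteq> 0" using eq assms(2) 3 by auto
    define c where "c = csqrt (b * a' / (b' * a))"
    have c2: "c ^ 2 = b * a' / (b' * a)" by (simp add: c_def)
    have "c ^ 4 = (c ^ 2) ^ 2" by simp
    also have "\<dots> = (a' ^ 3 * b ^ 2) / (b' ^ 2 * a ^ 2 * a')"
      unfolding c2 using 0 3 by (simp add: field_simps power2_eq_square power3_eq_cube)
    also have "\<dots> = a / a'"
      unfolding eq[symmetric] using 0 3 by (simp add: field_simps power2_eq_square power3_eq_cube)
    finally have c4: "c ^ 4 = a / a'" .
    have "c ^ 6 = c ^ 4 * c ^ 2" by (simp flip: power_add)
    also have "\<dots> = b / b'" unfolding c4 c2 using 0 3 by (simp add: field_simps)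
    finally have "c ^ 6 = b / b'" .
    moreover have "c \<noteq> 0" using 0 3 by (simp add: c_def)
    ultimately show ?thesis using that[of c] 0 c4 by simp
  qed
qed

lemma lattice_J_eq_iff_homothetic:
  assumes w: "Im (w1 / w2) > 0" and v: "Im (v1 / v2) > 0"
  shows "lattice_J (zlattice w1 w2) = lattice_J (zlattice v1 v2) \<longleftrightarrow>
         homothetic (zlattice w1 w2) (zlattice v1 v2)"
proof
  assume "homothetic (zlattice w1 w2) (zlattice v1 v2)"
  thus "lattice_J (zlattice w1 w2) = lattice_J (zlattice v1 v2)"
    using eisenstein_J_scale by (auto simp: lattice_J_eq w v homothetic_def)
next
  define L M where "L = zlattice w1 w2" and "M = zlattice v1 v2"
  interpret L: complex_lattice L unfolding L_def by (rule complex_lattice_zlattice[OF w])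
  interpret M: complex_lattice M unfolding M_def by (rule complex_lattice_zlattice[OF v])
  assume "lattice_J (zlattice w1 w2) = lattice_J (zlattice v1 v2)"
  hence "eisenstein_J L = eisenstein_J M" by (simp add: lattice_J_eq w v L_def M_def)
  then obtain c where c: "c \<noteq> 0" "eisenstein_sum L 4 = c ^ 4 * eisenstein_sum M 4"
      "eisenstein_sum L 6 = c ^ 6 * eisenstein_sum M 6"
    unfolding eisenstein_J_def
    using eisenstein_scaling_exists[OF L.discriminant_nonzero M.discriminant_nonzero] by blast
  \<comment> \<open>Scaling \<open>L\<close> by \<open>c\<close> divides its sums of weights 4 and 6
    by \<open>c ^ 4\<close> and \<open>c ^ 6\<close>, which turns them into those of
    \<open>M\<close>.\<close>
  have "complex_lattice ((*) c ` L)"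
    unfolding L_def zlattice_scale by (rule complex_lattice_zlattice) (use c(1) w in simp)
  hence "M = (*) c ` L"
    using c by (intro complex_lattice_eqI M.complex_lattice_axioms)
      (simp_all add: eisenstein_sum_scale power_divide)
  thus "homothetic (zlattice w1 w2) (zlattice v1 v2)"
    using c(1) unfolding homothetic_def L_def M_def by blast
qed

section \<open>Quadratic lattices\<close>

lemma zlattice_eqI:
  assumes "w1 \<in> zlattice v1 v2" "w2 \<in> zlattice v1 v2" "v1 \<in> zlattice w1 w2" "v2 \<in> zlattice w1 w2"
  shows "zlattice w1 w2 = zlattice v1 v2"
  using assms by (intro subset_antisym zlattice_subsetI)

lemma zlattice_uminus_right: "zlattice w1 (- w2) = zlattice w1 w2"
  by (rule zlattice_eqI)
     (auto intro: zlattice_basis zlattice_memI[of _ 0 _ "-1"])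

lemma zlattice_shift: "zlattice w1 (w2 + of_int k * w1) = zlattice w1 w2"
  by (rule zlattice_eqI)
     (auto intro: zlattice_basis zlattice_memI[of _ k _ 1] zlattice_memI[of _ "-k" _ 1])

text \<open>A change of basis multiplies this oriented area by an integer determinant; both
  directions together leave only a sign.\<close>

lemma covolume_eq:
  assumes "zlattice w1 w2 = zlattice v1 v2"
  shows "\<bar>Im (w1 * cnj w2)\<bar> = \<bar>Im (v1 * cnj v2)\<bar>"
proof -
  have mult: "\<exists>k :: int. Im (u1 * cnj u2) = k * Im (w1 * cnj w2)"
    if u: "u1 \<in> zlattice w1 w2" "u2 \<in> zlattice w1 w2" for w1 w2 u1 u2
  proof -
    obtain a b where u1: "u1 = of_int a * w1 + of_int b * w2" using u(1) by (auto simp: zlattice_def)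
    obtain c d where u2: "u2 = of_int c * w1 + of_int d * w2" using u(2) by (auto simp: zlattice_def)
    have "Im (u1 * cnj u2) = of_int (a * d - b * c) * Im (w1 * cnj w2)"
      unfolding u1 u2 by (simp add: algebra_simps)
    thus ?thesis by blast
  qed
  obtain k l :: int where k: "Im (v1 * cnj v2) = k * Im (w1 * cnj w2)"
      and l: "Im (w1 * cnj w2) = l * Im (v1 * cnj v2)"
    using mult[of v1 w1 w2 v2] mult[of w1 v1 v2 w2] assms zlattice_basis by metis
  have le: "\<bar>y\<bar> \<le> \<bar>x\<bar>" if "x = of_int m * y" "y = of_int n * x" for x y :: real and m n :: int
  proof (cases "m = 0")
    case False
    hence "1 \<le> \<bar>real_of_int m\<bar>" by linarith
    thus ?thesis using mult_right_mono[of 1 "\<bar>real_of_int m\<bar>" "\<bar>y\<bar>"] that(1) by (simp add: abs_mult)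
  qed (use that in auto)
  show ?thesis using le[OF k l] le[OF l k] by linarith
qed

text \<open>The form \<open>a x\<^sup>2 + b x y + c y\<^sup>2\<close> with root \<open>\<theta> / a\<close> in the upper half plane; the order is
  \<open>zlattice 1 \<theta>\<close>.\<close>

locale quadratic_lattice =
  fixes a b c N :: int and \<theta> :: complex
  assumes N_pos: "N > 0" and N_dvd: "N dvd c" and a_pos: "a > 0"
    and Im_pos: "Im \<theta> > 0"
    and sq: "\<theta>\<^sup>2 = - of_int b * \<theta> - of_int (a * c)"
    and cnj: "cnj \<theta> = - of_int b - \<theta>"
begin

lemma coord_eq:
  assumes "of_int m + of_int n * \<theta> = of_int m' + of_int n' * \<theta>"
  shows "m = m'" "n = n'"
proof -
  have "of_int n * Im \<theta> = of_int n' * Im \<theta>" using arg_cong[OF assms, of Im] by simp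
  thus "n = n'" using Im_pos by simp
  thus "m = m'" using assms by simp
qed

text \<open>Multiplication by \<open>\<mu>\<close> has index \<open>\<mu> cnj \<mu> = N\<close>; multiplying by \<open>cnj \<mu> / N\<close> inverts it.\<close>

lemma scale_of_norm:
  assumes \<mu>: "\<mu> = of_int (x * N) + of_int y * \<theta>" and norm: "\<mu> * cnj \<mu> = of_int N"
  shows "zlattice (of_int (a * N)) \<theta> = (*) \<mu> ` zlattice (of_int a) \<theta>"
  unfolding zlattice_scale
proof (rule zlattice_eqI[symmetric])
  \<comment> \<open>Divisibility of \<open>c\<close> by \<open>N\<close> makes both coordinates
    below integral: \<open>- (y * a * c)\<close> is a multiple of \<open>a * N\<close>, and
    \<open>y * d\<close> appears in the inverse.\<close>
  obtain d where c: "c = N * d" using N_dvd by auto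
  have cnj\<mu>: "cnj \<mu> = of_int (x * N - y * b) - of_int y * \<theta>"
    by (simp add: \<mu> cnj algebra_simps)
  have n: "of_int N = \<mu> * (of_int (x * N - y * b) - of_int y * \<theta>)"
    using norm cnj\<mu> by simp
  show "\<mu> * of_int a \<in> zlattice (of_int (a * N)) \<theta>"
    by (rule zlattice_memI[of _ x _ "y * a"]) (simp add: \<mu> algebra_simps)
  have "\<mu> * \<theta> = of_int (x * N) * \<theta> + of_int y * \<theta>\<^sup>2"
    by (simp add: \<mu> algebra_simps power2_eq_square)
  also have "\<dots> = of_int (- (y * d)) * of_int (a * N) + of_int (x * N - y * b) * \<theta>"
    by (simp add: sq c algebra_simps)
  finally show "\<mu> * \<theta> \<in> zlattice (of_int (a * N)) \<theta>" by (rule zlattice_memI)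
  have "of_int (a * N) = of_int a * (\<mu> * (of_int (x * N - y * b) - of_int y * \<theta>))"
    by (simp only: n[symmetric] of_int_mult)
  also have "\<dots> = of_int (x * N - y * b) * (\<mu> * of_int a) + of_int (- (y * a)) * (\<mu> * \<theta>)"
    by (simp add: algebra_simps)
  finally show "of_int (a * N) \<in> zlattice (\<mu> * of_int a) (\<mu> * \<theta>)" by (rule zlattice_memI)
  have "of_int N * \<theta> = \<mu> * (of_int (x * N - y * b) * \<theta> - of_int y * \<theta>\<^sup>2)"
    by (subst n) (simp add: algebra_simps power2_eq_square)
  also have "\<dots> = of_int N * (of_int (y * d) * (\<mu> * of_int a) + of_int x * (\<mu> * \<theta>))"
    by (simp add: sq c algebra_simps)
  finally have "\<theta> = of_int (y * d) * (\<mu> * of_int a) + of_int x * (\<mu> * \<theta>)"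
    using N_pos by simp
  thus "\<theta> \<in> zlattice (\<mu> * of_int a) (\<mu> * \<theta>)" by (rule zlattice_memI)
qed

text \<open>Scaling by \<mu> multiplies the covolume by \<open>(norm \<mu>)\<^sup>2\<close>, while
  replacing \<open>a\<close> by \<open>a * N\<close> multiplies it by \<open>N\<close>.\<close>

lemma norm_of_scale:
  assumes "zlattice (of_int (a * N)) \<theta> = (*) \<mu> ` zlattice (of_int a) \<theta>"
  shows "\<mu> * cnj \<mu> = of_int N"
proof -
  have "\<bar>Im (of_int (a * N) * cnj \<theta>)\<bar> = \<bar>Im (\<mu> * of_int a * cnj (\<mu> * \<theta>))\<bar>"
    using assms unfolding zlattice_scale by (rule covolume_eq)
  also have "\<mu> * of_int a * cnj (\<mu> * \<theta>) = of_real ((norm \<mu>)\<^sup>2 * a) * cnj \<theta>"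
    by (simp add: complex_norm_square[unfolded of_real_power] mult_ac)
  finally have "of_int (a * N) * Im \<theta> = (norm \<mu>)\<^sup>2 * of_int a * Im \<theta>"
    using Im_pos a_pos N_pos by (simp add: abs_mult)
  hence "(norm \<mu>)\<^sup>2 = of_int N" using Im_pos a_pos by simp
  thus ?thesis by (metis complex_norm_square of_real_of_int_eq)
qed

end

text \<open>Primitivity is what places the multiplier in the order: a factor \<open>\<mu>\<close> taking \<open>zlattice a \<theta>\<close> into
  \<open>zlattice (a N) \<theta>\<close> has the shape \<open>x N + (e / a) \<theta>\<close>, where \<open>a\<close> divides \<open>e b\<close> and \<open>e c\<close>.\<close>

lemma (in quadratic_lattice) homothetic_iff_principal:
  assumes prim: "Gcd {a, b, c} = 1"
  shows "homothetic (zlattice (of_int a) \<theta>) (zlattice (of_int (a * N)) \<theta>) \<longleftrightarrow>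
         homothetic (zlattice 1 \<theta>) (zlattice (of_int N) \<theta>)"
proof -
  \<comment> \<open>The order is the same situation for the form with coefficients \<open>1\<close>,
    \<open>b\<close>, \<open>a * c\<close>, which has the same \<theta>; the condition on \<mu> can
    thus be moved between the two.\<close>
  interpret O: quadratic_lattice 1 b "a * c" N \<theta>
    by unfold_locales (use N_pos N_dvd Im_pos sq cnj in auto)
  show ?thesis
  proof
    assume "homothetic (zlattice 1 \<theta>) (zlattice (of_int N) \<theta>)"
    then obtain \<mu> where \<mu>: "\<mu> \<noteq> 0" "zlattice (of_int N) \<theta> = (*) \<mu> ` zlattice 1 \<theta>"
      by (auto simp: homothetic_def)
    have norm: "\<mu> * cnj \<mu> = of_int N" using O.norm_of_scale[of \<mu>] \<mu>(2) by simp
    have "\<mu> \<in> zlattice (of_int N) \<theta>"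
      unfolding \<mu>(2) zlattice_scale using zlattice_basis(1)[of "\<mu> * 1" "\<mu> * \<theta>"] by simp
    then obtain x y where "\<mu> = of_int (x * N) + of_int y * \<theta>" by (auto simp: zlattice_def)
    from scale_of_norm[OF this norm] \<mu>(1)
    show "homothetic (zlattice (of_int a) \<theta>) (zlattice (of_int (a * N)) \<theta>)"
      by (auto simp: homothetic_def)
  next
    assume "homothetic (zlattice (of_int a) \<theta>) (zlattice (of_int (a * N)) \<theta>)"
    then obtain \<mu> where \<mu>: "\<mu> \<noteq> 0" "zlattice (of_int (a * N)) \<theta> = (*) \<mu> ` zlattice (of_int a) \<theta>"
      by (auto simp: homothetic_def)
    have norm: "\<mu> * cnj \<mu> = of_int N" by (rule norm_of_scale[OF \<mu>(2)])
    have mem: "\<mu> * of_int a \<in> zlattice (of_int (a * N)) \<theta>" "\<mu> * \<theta> \<in> zlattice (of_int (a * N)) \<theta>"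
      unfolding \<mu>(2) zlattice_scale by (rule zlattice_basis)+
    obtain x e where xe: "\<mu> * of_int a = of_int x * of_int (a * N) + of_int e * \<theta>"
      using mem(1) by (auto simp: zlattice_def)
    obtain u v where uv: "\<mu> * \<theta> = of_int u * of_int (a * N) + of_int v * \<theta>"
      using mem(2) by (auto simp: zlattice_def)
    \<comment> \<open>The product \<open>a * \<mu> * \<theta>\<close> is computed from
      \<open>xe\<close> and from \<open>uv\<close>; comparing coordinates gives the
      divisibilities.\<close>
    have "of_int (- (e * a * c)) + of_int (x * a * N - e * b) * \<theta> = (\<mu> * of_int a) * \<theta>"
    proof -
      have "(\<mu> * of_int a) * \<theta> = of_int (x * a * N) * \<theta> + of_int e * \<theta>\<^sup>2"
        unfolding xe by (simp add: algebra_simps power2_eq_square)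
      thus ?thesis by (simp add: sq algebra_simps)
    qed
    also have "\<dots> = of_int (u * a * a * N) + of_int (v * a) * \<theta>"
      using arg_cong[OF uv, of "\<lambda>z. of_int a * z"] by (simp add: algebra_simps)
    finally have 1: "- (e * a * c) = u * a * a * N" and 2: "x * a * N - e * b = v * a"
      by (blast dest: coord_eq)+
    have "a * (e * c) = a * (a * (- u * N))" using 1 by (simp add: algebra_simps)
    hence "e * c = a * (- u * N)" using a_pos mult_left_cancel[of a] by blast
    hence ec: "a dvd e * c" by (rule dvdI)
    have "e * b = a * (x * N - v)" using 2 by (simp add: algebra_simps)
    hence eb: "a dvd e * b" by (rule dvdI)
    \<comment> \<open>Neither \<open>b\<close> nor \<open>c\<close> need be coprime to
      \<open>a\<close>, but by primitivity their gcd is.\<close>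
    have "a dvd gcd (e * b) (e * c)" using ec eb by simp
    also have "\<dots> = \<bar>e\<bar> * gcd b c" by (simp add: gcd_mult_left abs_mult)
    finally have "a dvd \<bar>e\<bar> * gcd b c" .
    moreover have "coprime a (gcd b c)" using prim by (simp add: coprime_iff_gcd_eq_1)
    ultimately have "a dvd e" by (simp add: coprime_dvd_mult_left_iff)
    then obtain y where y: "e = a * y" by auto
    have "of_int a * \<mu> = of_int a * (of_int (x * N) + of_int y * \<theta>)"
      using xe by (simp add: y algebra_simps)
    hence "\<mu> = of_int (x * N) + of_int y * \<theta>" using a_pos by simp
    from O.scale_of_norm[OF this norm] \<mu>(1)
    show "homothetic (zlattice 1 \<theta>) (zlattice (of_int N) \<theta>)"
      by (auto simp: homothetic_def)
  qed
qed

section \<open>From the two ideals of a form to a condition on \<theta> alone\<close>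

lemma homothetic_scale_right_iff:
  assumes "d \<noteq> 0"
  shows "homothetic L ((*) d ` M) \<longleftrightarrow> homothetic L M"
proof
  assume "homothetic L ((*) d ` M)"
  then obtain c where c: "c \<noteq> 0" "(*) d ` M = (*) c ` L" by (auto simp: homothetic_def)
  have "M = (*) (1 / d) ` ((*) d ` M)" using assms by (auto simp: image_image)
  also have "\<dots> = (*) (c / d) ` L" unfolding c(2) by (simp add: image_image)
  finally show "homothetic L M" using c(1) assms unfolding homothetic_def by (intro exI[of _ "c / d"]) auto
next
  assume "homothetic L M"
  then obtain c where "c \<noteq> 0" "M = (*) c ` L" by (auto simp: homothetic_def)
  thus "homothetic L ((*) d ` M)"
    using assms unfolding homothetic_def by (intro exI[of _ "d * c"]) (auto simp: image_image mult.assoc)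
qed

lemma lattice_J_W_eq_iff:
  fixes q :: qform and D N :: int
  defines "\<theta> \<equiv> (- of_int (coeff_B q) + csqrt (of_int D)) / 2"
  assumes "D < 0" "N > 0" "primitive_form q" "positive_definite_form q" "qform_disc q = D"
    "N dvd coeff_C q"
  shows "lattice_J (form_ideal D q) = lattice_J (W_form_ideal N D q) \<longleftrightarrow>
         homothetic (zlattice 1 \<theta>) (zlattice (of_int N) \<theta>)"
proof -
  obtain a b c where q: "q = QForm a b c" by (cases q)
  define s where "s = csqrt (of_int D)"
  have "qform_eval q 1 0 > 0" "qform_eval q 0 1 > 0"
    using assms(5)[unfolded positive_definite_form_def, rule_format, of 1 0]
      assms(5)[unfolded positive_definite_form_def, rule_format, of 0 1] by simp_all
  hence a: "a > 0" and c: "c > 0" by (auto simp: q qform_eval_def)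
  have D: "D = b\<^sup>2 - 4 * a * c" using assms(6) by (simp add: q qform_disc_def)
  have s2: "s\<^sup>2 = of_int D" by (simp add: s_def)
  have s: "Re s = 0" "Im s > 0" using assms(2) by (simp_all add: s_def)
  have \<theta>: "\<theta> = (- of_int b + s) / 2" by (simp add: \<theta>_def q s_def)
  interpret quadratic_lattice a b c N \<theta>
  proof
    show "N dvd c" using assms(7) by (simp add: q)
    show "Im \<theta> > 0" using s by (simp add: \<theta>)
    have "s = 2 * \<theta> + of_int b" by (simp add: \<theta> field_simps)
    hence "(2 * \<theta> + of_int b)\<^sup>2 = of_int (b\<^sup>2 - 4 * a * c)" using s2 by (simp add: D)
    hence "4 * \<theta>\<^sup>2 = 4 * (- of_int b * \<theta> - of_int (a * c))"
      unfolding of_int_diff of_int_mult of_int_power of_int_numeral by algebra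
    thus "\<theta>\<^sup>2 = - of_int b * \<theta> - of_int (a * c)"
      by (subst (asm) mult_left_cancel) simp_all
    show "cnj \<theta> = - of_int b - \<theta>"
      using s by (simp add: \<theta> complex_eq_iff)
  qed (use a assms in auto)
  define \<eta> where "\<eta> = (of_int b + s) / 2"
  \<comment> \<open>The defining bases have negative orientation and are swapped, so that their
    quotients lie in the upper half plane.\<close>
  have "lattice_J (form_ideal D q) = lattice_J (zlattice \<theta> (of_int a))"
    by (simp add: form_ideal_def q \<theta> s_def zlattice_commute)
  moreover have "lattice_J (W_form_ideal N D q) = lattice_J (zlattice \<eta> (of_int c / of_int N))"
    by (simp add: W_form_ideal_def q \<eta>_def s_def zlattice_commute)
  moreover have "Im (\<theta> / of_int a) > 0" 
    using Im_pos a Im_divide_of_real[of \<theta> "of_int a"] by simp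
  moreover have "Im (\<eta> / (of_int c / of_int N)) > 0" 
    using s c assms(3) Im_divide_of_real[of \<eta> "of_int c / of_int N"] by (simp add: \<eta>_def)
  ultimately have "lattice_J (form_ideal D q) = lattice_J (W_form_ideal N D q) \<longleftrightarrow>
      homothetic (zlattice \<theta> (of_int a)) (zlattice \<eta> (of_int c / of_int N))"
    using lattice_J_eq_iff_homothetic by metis
  \<comment> \<open>The factor sends \<open>c / N\<close> to \<theta>; since \<eta> is
    \<open>\<theta> + b\<close> and hence \<open>\<theta> * \<eta> = - (a * c)\<close>, it sends
    \<eta> to \<open>- (a * N)\<close>.\<close>
  also have "\<dots> \<longleftrightarrow> homothetic (zlattice \<theta> (of_int a))
      ((*) (\<theta> * of_int N / of_int c) ` zlattice \<eta> (of_int c / of_int N))"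
    by (rule homothetic_scale_right_iff[symmetric]) (use Im_pos N_pos c in auto)
  also have "(*) (\<theta> * of_int N / of_int c) ` zlattice \<eta> (of_int c / of_int N) =
      zlattice (of_int (a * N)) \<theta>"
  proof -
    have "\<eta> = \<theta> + of_int b" by (simp add: \<theta> \<eta>_def field_simps)
    hence "\<theta> * \<eta> = - of_int (a * c)" using sq by algebra
    moreover have "\<theta> * of_int N / of_int c * \<eta> = of_int N / of_int c * (\<theta> * \<eta>)" by simp
    ultimately have "\<theta> * of_int N / of_int c * \<eta> = - of_int (a * N)"
      using c by (simp only:) simp
    moreover have "\<theta> * of_int N / of_int c * (of_int c / of_int N) = \<theta>" using c N_pos by simp
    ultimately have "(*) (\<theta> * of_int N / of_int c) ` zlattice \<eta> (of_int c / of_int N) =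
        zlattice (- of_int (a * N)) \<theta>" by (simp only: zlattice_scale)
    thus ?thesis using zlattice_uminus_right[of \<theta> "of_int (a * N)"] by (simp add: zlattice_commute)
  qed
  also have "homothetic (zlattice \<theta> (of_int a)) (zlattice (of_int (a * N)) \<theta>) \<longleftrightarrow>
      homothetic (zlattice 1 \<theta>) (zlattice (of_int N) \<theta>)"
    using homothetic_iff_principal assms(4) by (simp add: primitive_form_def q zlattice_commute)
  finally show ?thesis .
qed

theorem theorem4p7:
  fixes K :: "complex set" and f :: nat and p1 p2 N D B :: int
    and \<NN>\<^sub>B :: "qform set" and q :: "nat \<Rightarrow> qform"
  assumes "prime p1" and "prime p2" and "N = p1 * p2"
    and "imaginary_quadratic_field K" and "f > 0"
    and "is_order_discriminant (conductor_order K f) D" and "D < 0"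
    and "[B\<^sup>2 = D] (mod (4 * N))"
    and "N_system K (conductor_order K f) D N \<NN>\<^sub>B"
    and "QForm 1 B ((B\<^sup>2 - D) div 4) \<in> \<NN>\<^sub>B"
    and "bij_betw q {1..class_number K (conductor_order K f)} \<NN>\<^sub>B"
  shows "lattice_J (form_ideal D (q 1)) = lattice_J (W_form_ideal N D (q 1)) \<longleftrightarrow>
    (\<forall>i\<in>{1..class_number K (conductor_order K f)}.
       lattice_J (form_ideal D (q i)) = lattice_J (W_form_ideal N D (q i)))"
proof -
  define h where "h = class_number K (conductor_order K f)"
  have N: "N > 0" using assms(1-3) by (simp add: prime_gt_0_int)
  have S: "finite \<NN>\<^sub>B" "card \<NN>\<^sub>B = h"
    "\<And>q. q \<in> \<NN>\<^sub>B \<Longrightarrow> primitive_form q \<and> positive_definite_form q \<and> qform_disc q = D \<and> N dvd coeff_C q"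
    "\<And>q q'. q \<in> \<NN>\<^sub>B \<Longrightarrow> q' \<in> \<NN>\<^sub>B \<Longrightarrow> [coeff_B q = coeff_B q'] (mod (2 * N))"
    using assms(9) by (auto simp: N_system_def h_def)
  define \<theta> where "\<theta> = (- of_int B + csqrt (of_int D)) / 2"
  have iff: "lattice_J (form_ideal D q) = lattice_J (W_form_ideal N D q) \<longleftrightarrow>
               homothetic (zlattice 1 \<theta>) (zlattice (of_int N) \<theta>)" if q: "q \<in> \<NN>\<^sub>B" for q
  proof -
    define \<theta>' where "\<theta>' = (- of_int (coeff_B q) + csqrt (of_int D)) / 2"
    have "[B = coeff_B q] (mod (2 * N))" using S(4)[OF assms(10) q] by simp
    then obtain k where "coeff_B q = B + 2 * N * k" by (auto simp: cong_iff_lin)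
    \<comment> \<open>A congruence modulo \<open>2 * N\<close> becomes, after halving, a shift by a
      multiple of \<open>N\<close>, which is harmless in both lattices.\<close>
    hence \<theta>': "\<theta>' = \<theta> + of_int (- (N * k)) * 1" "\<theta>' = \<theta> + of_int (- k) * of_int N"
      by (simp_all add: \<theta>_def \<theta>'_def field_simps)
    have "zlattice 1 \<theta>' = zlattice 1 \<theta>" unfolding \<theta>'(1) by (rule zlattice_shift)
    moreover have "zlattice (of_int N) \<theta>' = zlattice (of_int N) \<theta>"
      unfolding \<theta>'(2) by (rule zlattice_shift)
    ultimately show ?thesis using lattice_J_W_eq_iff[OF assms(7) N] S(3)[OF q] by (simp add: \<theta>'_def)
  qed
  \<comment> \<open>The system contains the form with leading coefficient 1, so index 1 is in range
    and \<open>q 1\<close> is one of its members.\<close>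
  have "h \<ge> 1" using S(1,2) assms(10) by (metis One_nat_def Suc_leI card_gt_0_iff empty_iff)
  moreover have "q i \<in> \<NN>\<^sub>B" if "i \<in> {1..h}" for i
    using assms(11) that by (auto simp: h_def dest: bij_betwE)
  ultimately show ?thesis using iff unfolding h_def[symmetric] by auto
qed

end
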